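(* Let $T>0$, $n\ge 1$, and for $i=1,\dots,n$ let $f_i,a_i,g_i,e_i$ satisfy: (A) for each $i$, the Green function $G_i(t,s)$ of the $T$-periodic problem for $x_i''+a_i(t)x_i=e_i(t)$ satisfies $G_i(t,s)>0$ for all $(t,s)\in[0,T]\times[0,T]$; (H1) $f_i:\mathbb{R}^n\setminus\{0\}\to\mathbb{R}$ is continuous and $f_i(x)>0$ for $|x|>0$, $i=1,\dots,n$; (H2) $a_i,g_i,e_i:\mathbb{R}\to\mathbb{R}$ are continuous and $T$-periodic, $a_i(t)\ge 0$ and $g_i(t)\ge 0$ for $t\in[0,T]$, and $\int_0^T g_i(t)\,dt>0$, $i=1,\dots,n$. Assume also that $e_i(t)\ge 0$ for $t\in[0,T]$ and $\lim_{x\to 0}f_i(x)=\infty$ for $i=1,\dots,n$. For $\lambda>0$ consider the system $$\ddot{x}_i+a_i(t)x_i=\lambda g_i(t)f_i(x)+\lambda e_i(t),\qquad i=1,\dots,n. \quad ( * )$$ (a) If $\lim_{|x|\to\infty}\frac{f_i(x)}{|x|}=0$ for $i=1,\dots,n$, then for all $\lambda>0$ the system $( * )$ has a positive $T$-periodic solution. (b) If $\lim_{|x|\to\infty}\frac{f_i(x)}{|x|}=\infty$ for $i=1,\dots,n$, then for all sufficiently small $\lambda>0$ the system $( * )$ has two (distinct) positive $T$-periodic solutions. (c) There exists $\lambda_0>0$ such that $( * )$ has a positive $T$-periodic solution for $0<\lambda<\lambda_0$.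
   Context: For $x=(x_1,\dots,x_n)\in\mathbb{R}^n$, $|x|=\sum_{i=1}^n|x_i|$. The Green function $G_i$ in (A) is that of the scalar problem $x_i''+a_i(t)x_i=e_i(t)$ with periodic boundary conditions $x_i(0)=x_i(T)$, $x_i'(0)=x_i'(T)$: assumption (A) includes that it exists (i.e. the homogeneous periodic problem has only the trivial solution); $G_i$ is the continuous function on $[0,T]\times[0,T]$ such that, for every continuous $T$-periodic right-hand side $h$, the unique $T$-periodic solution of $x_i''+a_i(t)x_i=h(t)$ is given on $[0,T]$ by $x_i(t)=\int_0^T G_i(t,s)h(s)\,ds$. A positive $T$-periodic solution is a $T$-periodic function $x\in C^2(\mathbb{R},\mathbb{R}^n)$ solving the system, each of whose components satisfies $x_i(t)>0$ for all $t$. "For all sufficiently small $\lambda>0$" means: there is $\lambda_*>0$ such that the assertion holds for all $0<\lambda<\lambda_*$. *)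

theory Defs
  imports "HOL-Analysis.Analysis"
begin

definition l1_norm :: "real ^ 'n \<Rightarrow> real" where
  "l1_norm x = (\<Sum>i\<in>UNIV. \<bar>x $ i\<bar>)"

text \<open>\<open>x\<close> is of class $C^2$ on the real line with second derivative \<open>x2\<close>.\<close>

definition C2_with_second_deriv ::
    "(real \<Rightarrow> 'v::real_normed_vector) \<Rightarrow> (real \<Rightarrow> 'v) \<Rightarrow> bool" where
  "C2_with_second_deriv x x2 \<longleftrightarrow>
     (\<exists>x1. (\<forall>t. (x has_vector_derivative x1 t) (at t)) \<and>
           (\<forall>t. (x1 has_vector_derivative x2 t) (at t))) \<and>
     continuous_on UNIV x2"

text \<open>Solutions on \<open>{0..T}\<close> (derivatives one-sided at the endpoints) of $x'' + a(t) x = h(t)$,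
  $x(0) = x(T)$, $x'(0) = x'(T)$.\<close>

definition periodic_bvp_solution ::
    "real \<Rightarrow> (real \<Rightarrow> real) \<Rightarrow> (real \<Rightarrow> real) \<Rightarrow> (real \<Rightarrow> real) \<Rightarrow> bool" where
  "periodic_bvp_solution T a h x \<longleftrightarrow>
     (\<exists>x1 x2.
        (\<forall>t\<in>{0..T}. (x has_vector_derivative x1 t) (at t within {0..T})) \<and>
        (\<forall>t\<in>{0..T}. (x1 has_vector_derivative x2 t) (at t within {0..T})) \<and>
        (\<forall>t\<in>{0..T}. x2 t + a t * x t = h t) \<and>
        x 0 = x T \<and> x1 0 = x1 T)"

definition only_trivial_periodic_solution :: "real \<Rightarrow> (real \<Rightarrow> real) \<Rightarrow> bool" where
  "only_trivial_periodic_solution T a \<longleftrightarrow>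
     (\<forall>x. periodic_bvp_solution T a (\<lambda>_. 0) x \<longrightarrow> (\<forall>t\<in>{0..T}. x t = 0))"

definition scalar_periodic_solution ::
    "real \<Rightarrow> (real \<Rightarrow> real) \<Rightarrow> (real \<Rightarrow> real) \<Rightarrow> (real \<Rightarrow> real) \<Rightarrow> bool" where
  "scalar_periodic_solution T a h x \<longleftrightarrow>
     periodic_fun_simple x T \<and>
     (\<exists>x2. C2_with_second_deriv x x2 \<and> (\<forall>t. x2 t + a t * x t = h t))"

text \<open>The Green function is determined only on the square \<open>{0..T} \<times> {0..T}\<close>; the values of \<open>G\<close>
  elsewhere are irrelevant.\<close>

definition is_green_function ::
    "real \<Rightarrow> (real \<Rightarrow> real) \<Rightarrow> (real \<Rightarrow> real \<Rightarrow> real) \<Rightarrow> bool" where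
  "is_green_function T a G \<longleftrightarrow>
     only_trivial_periodic_solution T a \<and>
     continuous_on ({0..T} \<times> {0..T}) (\<lambda>(t, s). G t s) \<and>
     (\<forall>h. continuous_on UNIV h \<and> periodic_fun_simple h T \<longrightarrow>
        (\<exists>!x. scalar_periodic_solution T a h x) \<and>
        (\<forall>x. scalar_periodic_solution T a h x \<longrightarrow>
           (\<forall>t\<in>{0..T}. x t = integral {0..T} (\<lambda>s. G t s * h s))))"

text \<open>The nonlinearities are total functions here, but \<open>f i\<close> is only ever evaluated at
  \<open>x t \<noteq> 0\<close>, all components of \<open>x t\<close> being positive.\<close>

definition positive_periodic_solution ::
    "real \<Rightarrow> ('n \<Rightarrow> real \<Rightarrow> real) \<Rightarrow> ('n \<Rightarrow> real \<Rightarrow> real) \<Rightarrow> ('n \<Rightarrow> real \<Rightarrow> real) \<Rightarrow>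
     ('n \<Rightarrow> real ^ 'n \<Rightarrow> real) \<Rightarrow> real \<Rightarrow> (real \<Rightarrow> real ^ 'n) \<Rightarrow> bool" where
  "positive_periodic_solution T a g e f lam x \<longleftrightarrow>
     periodic_fun_simple x T \<and>
     (\<forall>t i. x t $ i > 0) \<and>
     (\<exists>x2. C2_with_second_deriv x x2 \<and>
        (\<forall>t i. x2 t $ i + a i t * x t $ i = lam * g i t * f i (x t) + lam * e i t))"

end

theory Submission
  imports Defs "HOL-Complex_Analysis.Great_Picard"
begin

text \<open>Positive periodic solutions are the fixed points of
\<open>F x t = \<integral> G t s (\<lambda> g s f (x s) + \<lambda> e s) ds\<close>, taken componentwise. Since the kernels are continuous
and positive on a compact square, they lie between constants \<open>0 < m \<le> M\<close>, and with \<open>\<sigma> = m / M\<close>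
every value \<open>F x\<close> satisfies the Harnack inequality \<open>\<sigma> |F x s| \<le> |F x t|\<close> for all \<open>s\<close> and \<open>t\<close>. All
solutions thus live in the cone of paths with nonnegative components on which \<open>|x t|\<close> is comparable
with the single number \<open>\<rho> = |x 0|\<close>. Such a path stays away from the origin, so the singularity of
\<open>f\<close> never interferes, and its size \<open>\<rho>\<close> may serve as the norm in Krasnoselskii's fixed point
theorem: if \<open>F\<close> increases the size on one of two shells \<open>\<rho> = r\<close>, \<open>\<rho> = R\<close> and decreases it on the
other one, then it has a fixed point between them (\<open>krasnoselskii_annulus\<close>, \<open>solution_in_annulus\<close>).

Four estimates supply the shells. Near zero \<open>f \<ge> 1\<close>, hence \<open>|F x 0|\<close> is bounded below by a fixed
positive number and exceeds small sizes (\<open>expands_near_zero\<close>). On large shells a sublinear \<open>f\<close>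
makes \<open>F\<close> decrease the size, a superlinear one makes it increase
(\<open>contracts_at_infinity_if_sublinear\<close>, \<open>expands_at_infinity_if_superlinear\<close>). On the shell \<open>\<rho> = 1\<close>
the nonlinearity is bounded, so \<open>F\<close> strictly decreases the size once the parameter is small
(\<open>contracts_on_unit_shell_if_small_parameter\<close>). Combining the first estimate with the second gives
(a), with the fourth gives (c); under superlinear growth the fourth and third give one more
solution, and the strict inequality at \<open>\<rho> = 1\<close> keeps the two apart, which is (b).

The fixed point theorem reduces to Schauder's theorem by a change of variables. Writing a path as
\<open>\<rho> u\<close> with \<open>|u 0| = 1\<close>, one iterates the direction, \<open>u \<mapsto> F (\<rho> u) / |F (\<rho> u) 0|\<close>, and the size,
\<open>\<rho> \<mapsto> \<rho> + \<tau> (|F (\<rho> u) 0| - \<rho>)\<close>, the latter truncated to \<open>{r..R}\<close>. The sign \<open>\<tau> = 1\<close> serves the case in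
which \<open>F\<close> pushes sizes into the annulus, \<open>\<tau> = -1\<close> the case in which it pushes them out. Schauder's theorem itself is
obtained for continuous functions on a compact set: a partition of unity reduces approximate fixed
points to Brouwer's theorem on a cube whose dimension is a variable natural number, for which
Kuhn's combinatorial lemma is used directly, and the Arzela-Ascoli theorem provides the limit.\<close>

section \<open>Brouwer's theorem on a finite-dimensional cube\<close>

text \<open>The dimension of the cube is the cardinality of an arbitrary finite index set, not a type, because
the Schauder argument below lets it grow. For every mesh size Kuhn's lemma yields a grid cell in
which, for each coordinate \<open>i\<close>, some corner has \<open>F v i \<ge> v i\<close> and some corner has \<open>F v i \<le> v i\<close>. Cells
for finer and finer meshes accumulate at a point, where continuity turns both into an equality.\<close>

theorem brouwer_finite_cube:
  fixes F :: "('i \<Rightarrow> real) \<Rightarrow> 'i \<Rightarrow> real" and lo hi :: "'i \<Rightarrow> real"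
  assumes fin: "finite I" and lohi: "\<And>i. i \<in> I \<Longrightarrow> lo i \<le> hi i"
    and maps: "\<And>v i. (\<And>j. j \<in> I \<Longrightarrow> v j \<in> {lo j..hi j}) \<Longrightarrow> i \<in> I \<Longrightarrow> F v i \<in> {lo i..hi i}"
    and cont: "\<And>V v i. (\<And>k j. j \<in> I \<Longrightarrow> V k j \<in> {lo j..hi j}) \<Longrightarrow>
                 (\<And>j. j \<in> I \<Longrightarrow> (\<lambda>k::nat. V k j) \<longlonglongrightarrow> v j) \<Longrightarrow> i \<in> I \<Longrightarrow>
                 (\<lambda>k. F (V k) i) \<longlonglongrightarrow> F v i"
  obtains v where "\<And>i. i \<in> I \<Longrightarrow> v i \<in> {lo i..hi i}" and "\<And>i. i \<in> I \<Longrightarrow> F v i = v i"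
proof -
  define n where "n = card I"
  obtain idx where idx: "bij_betw idx I {0..<n}"
    using fin ex_bij_betw_finite_nat n_def by blast
  have idx_less: "idx i < n" if "i \<in> I" for i
    using idx that by (auto simp: bij_betw_def)
  define pt where "pt p x i = lo i + real (x (idx i)) / real p * (hi i - lo i)" for p x i
  have pt_in: "pt p x i \<in> {lo i..hi i}" if "p > 0" "i \<in> I" "x (idx i) \<le> p" for p x i
  proof -
    have "0 \<le> real (x (idx i)) / real p" "real (x (idx i)) / real p \<le> 1"
      using that by (auto simp: field_simps)
    then have "0 \<le> real (x (idx i)) / real p * (hi i - lo i)"
       "real (x (idx i)) / real p * (hi i - lo i) \<le> 1 * (hi i - lo i)"
      using lohi[OF that(2)] by (intro mult_nonneg_nonneg mult_right_mono; simp)+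
    then show ?thesis by (simp add: pt_def)
  qed
  have "\<exists>q. (\<forall>i<n. q i < Suc k) \<and> (\<forall>i\<in>I. \<exists>r s.
      (\<forall>j<n. q j \<le> r j \<and> r j \<le> q j + 1) \<and> (\<forall>j<n. q j \<le> s j \<and> s j \<le> q j + 1) \<and>
      pt (Suc k) r i \<le> F (pt (Suc k) r) i \<and> F (pt (Suc k) s) i \<le> pt (Suc k) s i)" for k
  proof -
    define p where "p = Suc k"
    have p: "p > 0" by (simp add: p_def)
    \<comment> \<open>Label 0 means that the map does not decrease coordinate \<open>m\<close>, label 1 that it does not increase it; on the faces this is automatic because the map preserves the cube.\<close>
    define lab where "lab x m = (if x m = 0 \<or> x m < p \<and>
       pt p x (inv_into I idx m) \<le> F (pt p x) (inv_into I idx m) then 0 else 1::nat)"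
      for x :: "nat \<Rightarrow> nat" and m
    obtain q where q: "\<forall>i<n. q i < p"
      and rs: "\<forall>i<n. \<exists>r s. (\<forall>j<n. q j \<le> r j \<and> r j \<le> q j + 1) \<and>
                (\<forall>j<n. q j \<le> s j \<and> s j \<le> q j + 1) \<and> lab r i \<noteq> lab s i"
      by (rule kuhn_lemma[OF p, of n lab]) (use p in \<open>auto simp: lab_def\<close>)
    have inv: "inv_into I idx (idx i) = i" if "i \<in> I" for i
      using idx that by (simp add: bij_betw_def)
    have box: "pt p r j \<in> {lo j..hi j}"
      if "\<forall>j<n. q j \<le> r j \<and> r j \<le> q j + 1" "j \<in> I" for r j
    proof (rule pt_in[OF p that(2)])
      have "r (idx j) \<le> q (idx j) + 1" "q (idx j) < p" using that idx_less q by blast+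
      then show "r (idx j) \<le> p" by simp
    qed
    have lab0: "pt p r i \<le> F (pt p r) i"
      if "i \<in> I" "\<forall>j<n. q j \<le> r j \<and> r j \<le> q j + 1" "lab r (idx i) = 0" for r i
    proof (cases "r (idx i) = 0")
      case True
      then have "pt p r i = lo i" by (simp add: pt_def)
      then show ?thesis using maps[OF box[OF that(2)] that(1)] by simp
    next
      case False
      then show ?thesis using that inv[OF that(1)] by (auto simp: lab_def split: if_splits)
    qed
    have lab1: "F (pt p r) i \<le> pt p r i"
      if "i \<in> I" "\<forall>j<n. q j \<le> r j \<and> r j \<le> q j + 1" "lab r (idx i) \<noteq> 0" for r i
    proof (cases "r (idx i) < p")
      case True
      then show ?thesis using that inv[OF that(1)] by (auto simp: lab_def split: if_splits)
    next
      case False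
      have "r (idx i) \<le> q (idx i) + 1" "q (idx i) < p"
        using that idx_less q by blast+
      then have "r (idx i) = p" using False by simp
      then have "pt p r i = hi i" using p by (simp add: pt_def)
      then show ?thesis using maps[OF box[OF that(2)] that(1)] by simp
    qed
    show ?thesis
    proof (rule exI[of _ q], rule conjI)
      show "\<forall>i<n. q i < Suc k" using q p_def by simp
    next
      show "\<forall>i\<in>I. \<exists>r s. (\<forall>j<n. q j \<le> r j \<and> r j \<le> q j + 1) \<and> (\<forall>j<n. q j \<le> s j \<and> s j \<le> q j + 1) \<and>
          pt (Suc k) r i \<le> F (pt (Suc k) r) i \<and> F (pt (Suc k) s) i \<le> pt (Suc k) s i"
      proof
        fix i assume i: "i \<in> I"
        obtain r s where r: "\<forall>j<n. q j \<le> r j \<and> r j \<le> q j + 1"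
          and s: "\<forall>j<n. q j \<le> s j \<and> s j \<le> q j + 1" and ne: "lab r (idx i) \<noteq> lab s (idx i)"
          using rs idx_less[OF i] by blast
        have "lab r (idx i) = 0 \<and> lab s (idx i) \<noteq> 0 \<or> lab r (idx i) \<noteq> 0 \<and> lab s (idx i) = 0"
          using ne by (auto simp: lab_def split: if_splits)
        then show "\<exists>r s. (\<forall>j<n. q j \<le> r j \<and> r j \<le> q j + 1) \<and> (\<forall>j<n. q j \<le> s j \<and> s j \<le> q j + 1) \<and>
            pt (Suc k) r i \<le> F (pt (Suc k) r) i \<and> F (pt (Suc k) s) i \<le> pt (Suc k) s i"
          using lab0[OF i] lab1[OF i] r s unfolding p_def[symmetric] by blast
      qed
    qed
  qed
  then obtain q where q: "\<And>k i. i < n \<Longrightarrow> q k i < Suc k"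
    and rs: "\<And>k i. i \<in> I \<Longrightarrow> \<exists>r s.
      (\<forall>j<n. q k j \<le> r j \<and> r j \<le> q k j + 1) \<and> (\<forall>j<n. q k j \<le> s j \<and> s j \<le> q k j + 1) \<and>
      pt (Suc k) r i \<le> F (pt (Suc k) r) i \<and> F (pt (Suc k) s) i \<le> pt (Suc k) s i"
    by metis
  define Q where "Q k = pt (Suc k) (q k)" for k
  have Q_in: "Q k i \<in> {lo i..hi i}" if "i \<in> I" for k i
    unfolding Q_def using q[OF idx_less[OF that], of k] that by (intro pt_in) auto
  have "\<exists>l r. strict_mono (r :: nat \<Rightarrow> nat) \<and>
     (\<forall>\<epsilon>>0. eventually (\<lambda>k. \<forall>i\<in>I. dist (Q (r k) i) (l i) < \<epsilon>) sequentially)"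
  proof (rule compact_lemma_general[where proj="\<lambda>x i. x i" and unproj="\<lambda>x. x" and basis=I,
        rule_format, OF fin])
    fix i assume "i \<in> I"
    then have "(\<lambda>x. x i) ` range Q \<subseteq> {lo i..hi i}" using Q_in by auto
    then show "bounded ((\<lambda>x. x i) ` range Q)"
      using bounded_closed_interval bounded_subset by blast
  qed auto
  then obtain v \<sigma> where \<sigma>: "strict_mono (\<sigma> :: nat \<Rightarrow> nat)"
    and lim: "\<And>\<epsilon>. \<epsilon> > 0 \<Longrightarrow> eventually (\<lambda>k. \<forall>i\<in>I. dist (Q (\<sigma> k) i) (v i) < \<epsilon>) sequentially"
    by blast
  have Qlim: "(\<lambda>k. Q (\<sigma> k) i) \<longlonglongrightarrow> v i" if "i \<in> I" for i
    using lim that by (intro tendstoI) (fast elim: eventually_mono)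
  have v_in: "v i \<in> {lo i..hi i}" if "i \<in> I" for i
    by (rule Lim_in_closed_set[OF closed_atLeastAtMost _ _ Qlim[OF that]])
       (use Q_in[OF that] in \<open>auto intro!: always_eventually\<close>)
  \<comment> \<open>A corner of the \<open>k\<close>-th cell differs from \<open>Q k\<close> by at most one grid step, which vanishes.\<close>
  have corner: "(\<lambda>k. pt (Suc (\<sigma> k)) (x k) i) \<longlonglongrightarrow> v i"
    if x: "\<And>k. \<forall>j<n. q (\<sigma> k) j \<le> x k j \<and> x k j \<le> q (\<sigma> k) j + 1" and i: "i \<in> I" for x i
  proof -
    have step: "norm (pt (Suc (\<sigma> k)) (x k) i - Q (\<sigma> k) i) \<le> (hi i - lo i) * inverse (real (Suc k))" for k
    proof -
      have b: "q (\<sigma> k) (idx i) \<le> x k (idx i)" "x k (idx i) \<le> q (\<sigma> k) (idx i) + 1"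
        using x idx_less[OF i] by blast+
      have "pt (Suc (\<sigma> k)) (x k) i - Q (\<sigma> k) i
        = (hi i - lo i) * (real (x k (idx i)) - real (q (\<sigma> k) (idx i))) * inverse (real (Suc (\<sigma> k)))"
        by (simp add: pt_def Q_def divide_inverse algebra_simps)
      moreover have "\<bar>real (x k (idx i)) - real (q (\<sigma> k) (idx i))\<bar> \<le> 1" using b by auto
      moreover have "inverse (real (Suc (\<sigma> k))) \<le> inverse (real (Suc k))"
        using seq_suble[OF \<sigma>, of k] by (simp add: field_simps)
      ultimately have "norm (pt (Suc (\<sigma> k)) (x k) i - Q (\<sigma> k) i)
          \<le> (hi i - lo i) * 1 * inverse (real (Suc k))"
        using lohi[OF i] by (simp only: real_norm_def abs_mult) (intro mult_mono, auto)
      then show ?thesis by simp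
    qed
    have "(\<lambda>k. (hi i - lo i) * inverse (real (Suc k))) \<longlonglongrightarrow> 0"
      using tendsto_mult_left[OF LIMSEQ_inverse_real_of_nat, of "hi i - lo i"] by simp
    then have "(\<lambda>k. pt (Suc (\<sigma> k)) (x k) i - Q (\<sigma> k) i) \<longlonglongrightarrow> 0"
      by (rule Lim_null_comparison[rotated]) (intro always_eventually allI step)
    from tendsto_add[OF this Qlim[OF i]] show ?thesis by simp
  qed
  have "F v i = v i" if i: "i \<in> I" for i
  proof -
    have "\<forall>k. \<exists>r s.
      (\<forall>j<n. q (\<sigma> k) j \<le> r j \<and> r j \<le> q (\<sigma> k) j + 1) \<and> (\<forall>j<n. q (\<sigma> k) j \<le> s j \<and> s j \<le> q (\<sigma> k) j + 1) \<and>
      pt (Suc (\<sigma> k)) r i \<le> F (pt (Suc (\<sigma> k)) r) i \<and> F (pt (Suc (\<sigma> k)) s) i \<le> pt (Suc (\<sigma> k)) s i"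
      using rs[OF i] by blast
    then obtain R S where R: "\<And>k. \<forall>j<n. q (\<sigma> k) j \<le> R k j \<and> R k j \<le> q (\<sigma> k) j + 1"
      and S: "\<And>k. \<forall>j<n. q (\<sigma> k) j \<le> S k j \<and> S k j \<le> q (\<sigma> k) j + 1"
      and leR: "\<And>k. pt (Suc (\<sigma> k)) (R k) i \<le> F (pt (Suc (\<sigma> k)) (R k)) i"
      and leS: "\<And>k. F (pt (Suc (\<sigma> k)) (S k)) i \<le> pt (Suc (\<sigma> k)) (S k) i"
      by metis
    have box: "pt (Suc (\<sigma> k)) (x k) j \<in> {lo j..hi j}"
      if "\<And>k. \<forall>j<n. q (\<sigma> k) j \<le> x k j \<and> x k j \<le> q (\<sigma> k) j + 1" "j \<in> I" for x k j
    proof (rule pt_in)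
      have "x k (idx j) \<le> q (\<sigma> k) (idx j) + 1" "q (\<sigma> k) (idx j) < Suc (\<sigma> k)"
        using that idx_less q by blast+
      then show "x k (idx j) \<le> Suc (\<sigma> k)" by simp
    qed (use that in auto)
    have "(\<lambda>k. F (pt (Suc (\<sigma> k)) (R k)) i) \<longlonglongrightarrow> F v i" "(\<lambda>k. F (pt (Suc (\<sigma> k)) (S k)) i) \<longlonglongrightarrow> F v i"
      by (intro cont i corner R S box; assumption)+
    then have "v i \<le> F v i" "F v i \<le> v i"
      using LIMSEQ_le[OF corner[OF R i]] LIMSEQ_le[OF _ corner[OF S i]] leR leS by blast+
    then show ?thesis by simp
  qed
  with v_in show ?thesis using that by blast
qed

section \<open>Schauder's theorem for equicontinuous families\<close>

definition continuous_into :: "'a::topological_space set \<Rightarrow> 'b::topological_space set \<Rightarrow> ('a \<Rightarrow> 'b) set" where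
  "continuous_into S B = {x. continuous_on S x \<and> x ` S \<subseteq> B}"

text \<open>A function is replaced by its values on a finite \<open>\<delta>\<close>-net, interpolated by a partition of unity
subordinate to the balls around the net points; the interpolants \<open>z v\<close> are parametrised by a cube.
A Brouwer fixed point of \<open>v \<mapsto> \<Phi> (z v)\<close>, read off at the net points, is a function whose value at \<open>t\<close> is a convex
combination of values of its image under \<open>\<Phi>\<close> at points within \<open>\<delta>\<close> of \<open>t\<close>.\<close>

lemma schauder_approximate_fixed_point:
  fixes \<Phi> :: "('a::euclidean_space \<Rightarrow> 'b::euclidean_space) \<Rightarrow> 'a \<Rightarrow> 'b"
  assumes S: "compact S" and ab: "cbox a b \<noteq> {}"
    and maps: "\<And>x t. x \<in> continuous_into S (cbox a b) \<Longrightarrow> t \<in> S \<Longrightarrow> \<Phi> x t \<in> cbox a b"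
    and cont: "\<And>Y x t. (\<And>k::nat. Y k \<in> continuous_into S (cbox a b)) \<Longrightarrow>
        x \<in> continuous_into S (cbox a b) \<Longrightarrow> uniform_limit S Y x sequentially \<Longrightarrow> t \<in> S \<Longrightarrow>
        (\<lambda>k. \<Phi> (Y k) t) \<longlonglongrightarrow> \<Phi> x t"
    and \<delta>: "\<delta> > 0"
  obtains y where "y \<in> continuous_into S (cbox a b)"
    and "\<And>t. t \<in> S \<Longrightarrow> y t \<in> convex hull (\<Phi> y ` (S \<inter> ball t \<delta>))"
proof -
  obtain K where K: "finite K" "K \<subseteq> S" "S \<subseteq> (\<Union>p\<in>K. ball p \<delta>)"
    using compactE_image[OF S, of S "\<lambda>p. ball p \<delta>"] \<delta> by (metis UN_I centre_in_ball open_ball subsetI)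
  define w where "w p t = max 0 (\<delta> - dist t p)" for p t :: 'a
  define W where "W t = (\<Sum>p\<in>K. w p t)" for t
  define \<phi> where "\<phi> p t = w p t / W t" for p t
  define val where "val v p = (\<Sum>c\<in>Basis. v (p, c) *\<^sub>R c)" for v :: "'a \<times> 'b \<Rightarrow> real" and p
  define z where "z v t = (\<Sum>p\<in>K. \<phi> p t *\<^sub>R val v p)" for v :: "'a \<times> 'b \<Rightarrow> real" and t
  have w0: "w p t \<ge> 0" for p t by (simp add: w_def)
  have W_pos: "W t > 0" if t: "t \<in> S" for t
  proof -
    obtain p where "p \<in> K" "t \<in> ball p \<delta>" using K t by blast
    then show ?thesis unfolding W_def
      by (intro sum_pos2[OF K(1), of p]) (auto simp: w_def dist_commute)
  qed
  have \<phi>0: "\<phi> p t \<ge> 0" if "t \<in> S" for p t using w0 W_pos[OF that] by (simp add: \<phi>_def)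
  have \<phi>1: "(\<Sum>p\<in>K. \<phi> p t) = 1" if "t \<in> S" for t
    using W_pos[OF that] by (simp add: \<phi>_def sum_divide_distrib[symmetric] W_def[symmetric])
  have \<phi>_le: "\<phi> p t \<le> 1" if "t \<in> S" "p \<in> K" for p t
    using \<phi>1[OF that(1)] member_le_sum[of p K "\<lambda>p. \<phi> p t"] \<phi>0 K that by auto
  have cont_\<phi>: "continuous_on S (\<phi> p)" for p
    unfolding \<phi>_def W_def w_def
    by (intro continuous_intros) (use W_pos in \<open>force simp: W_def w_def\<close>)
  have val_inner: "val v p \<bullet> c = v (p, c)" if "c \<in> Basis" for v p c
    using that by (simp add: val_def inner_sum_left inner_Basis if_distrib cong: if_cong)
  have val_in: "val v p \<in> cbox a b"
    if "\<And>i. i \<in> K \<times> Basis \<Longrightarrow> v i \<in> {a \<bullet> snd i..b \<bullet> snd i}" "p \<in> K" for v p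
    using that by (force simp: mem_box val_inner)
  have z_in: "z v \<in> continuous_into S (cbox a b)"
    if v: "\<And>i. i \<in> K \<times> Basis \<Longrightarrow> v i \<in> {a \<bullet> snd i..b \<bullet> snd i}" for v
  proof -
    have "z v t \<in> cbox a b" if t: "t \<in> S" for t
      unfolding z_def using K(1) \<phi>0[OF t] \<phi>1[OF t] val_in[OF v]
      by (intro convex_sum) auto
    moreover have "continuous_on S (z v)"
      unfolding z_def by (intro continuous_intros cont_\<phi>)
    ultimately show ?thesis by (auto simp: continuous_into_def)
  qed
  obtain v where v_in: "\<And>i. i \<in> K \<times> Basis \<Longrightarrow> v i \<in> {a \<bullet> snd i..b \<bullet> snd i}"
    and v_fix: "\<And>i. i \<in> K \<times> Basis \<Longrightarrow> \<Phi> (z v) (fst i) \<bullet> snd i = v i"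
  proof (rule brouwer_finite_cube[of "K \<times> (Basis :: 'b set)" "\<lambda>i. a \<bullet> snd i" "\<lambda>i. b \<bullet> snd i"
        "\<lambda>v i. \<Phi> (z v) (fst i) \<bullet> snd i"])
    fix V :: "nat \<Rightarrow> 'a \<times> 'b \<Rightarrow> real" and v i
    assume V: "\<And>k j. j \<in> K \<times> Basis \<Longrightarrow> V k j \<in> {a \<bullet> snd j..b \<bullet> snd j}"
      and lim: "\<And>j. j \<in> K \<times> Basis \<Longrightarrow> (\<lambda>k. V k j) \<longlonglongrightarrow> v j"
      and i: "i \<in> K \<times> (Basis :: 'b set)"
    have v: "v j \<in> {a \<bullet> snd j..b \<bullet> snd j}" if "j \<in> K \<times> Basis" for j
      by (rule Lim_in_closed_set[OF closed_atLeastAtMost _ _ lim[OF that]])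
         (use V[OF that] in \<open>auto intro!: always_eventually\<close>)
    have "(\<lambda>k. val (V k) p) \<longlonglongrightarrow> val v p" if "p \<in> K" for p
      unfolding val_def using that by (intro tendsto_intros lim) auto
    then have D: "(\<lambda>k. \<Sum>p\<in>K. norm (val (V k) p - val v p)) \<longlonglongrightarrow> 0"
      by (intro tendsto_null_sum) (simp add: LIM_zero tendsto_norm_zero)
    have "uniform_limit S (\<lambda>k. z (V k)) (z v) sequentially"
    proof (rule uniform_limitI)
      fix \<epsilon> :: real assume "\<epsilon> > 0"
      with D have "\<forall>\<^sub>F k in sequentially. (\<Sum>p\<in>K. norm (val (V k) p - val v p)) < \<epsilon>"
        by (rule order_tendstoD)
      then show "\<forall>\<^sub>F k in sequentially. \<forall>t\<in>S. dist (z (V k) t) (z v t) < \<epsilon>"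
      proof (rule eventually_mono, intro ballI)
        fix k t assume small: "(\<Sum>p\<in>K. norm (val (V k) p - val v p)) < \<epsilon>" and t: "t \<in> S"
        have "dist (z (V k) t) (z v t) = norm (\<Sum>p\<in>K. \<phi> p t *\<^sub>R (val (V k) p - val v p))"
          by (simp add: z_def dist_norm sum_subtractf scaleR_diff_right)
        also have "\<dots> \<le> (\<Sum>p\<in>K. norm (val (V k) p - val v p))"
          using \<phi>0[OF t] \<phi>_le[OF t] by (intro sum_norm_le) (auto intro: mult_left_le_one_le)
        finally show "dist (z (V k) t) (z v t) < \<epsilon>" using small by simp
      qed
    qed
    then have "(\<lambda>k. \<Phi> (z (V k)) (fst i)) \<longlonglongrightarrow> \<Phi> (z v) (fst i)"
      using z_in[OF V] z_in[OF v] i K(2) by (intro cont) auto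
    then show "(\<lambda>k. \<Phi> (z (V k)) (fst i) \<bullet> snd i) \<longlonglongrightarrow> \<Phi> (z v) (fst i) \<bullet> snd i"
      by (intro tendsto_intros)
  next
    fix i assume "i \<in> K \<times> (Basis :: 'b set)"
    then show "a \<bullet> snd i \<le> b \<bullet> snd i" using ab by (auto simp: box_ne_empty)
  next
    fix v :: "'a \<times> 'b \<Rightarrow> real" and i
    assume "\<And>j. j \<in> K \<times> Basis \<Longrightarrow> v j \<in> {a \<bullet> snd j..b \<bullet> snd j}" and i: "i \<in> K \<times> (Basis :: 'b set)"
    then have "\<Phi> (z v) (fst i) \<in> cbox a b" using K(2) by (intro maps z_in) auto
    then show "\<Phi> (z v) (fst i) \<bullet> snd i \<in> {a \<bullet> snd i..b \<bullet> snd i}" using i by (auto simp: mem_box)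
  qed (use K in auto)
  have val_fix: "val v p = \<Phi> (z v) p" if "p \<in> K" for p
  proof (rule euclidean_eqI)
    fix c :: 'b assume "c \<in> Basis"
    then show "val v p \<bullet> c = \<Phi> (z v) p \<bullet> c" using v_fix[of "(p, c)"] that by (simp add: val_inner)
  qed
  have "z v t \<in> convex hull (\<Phi> (z v) ` (S \<inter> ball t \<delta>))" if t: "t \<in> S" for t
  proof -
    define L where "L = {p \<in> K. dist t p < \<delta>}"
    have off: "\<phi> p t = 0" if "p \<in> K - L" for p using that by (auto simp: L_def \<phi>_def w_def)
    have L: "finite L" "L \<subseteq> K" using K by (auto simp: L_def)
    have "z v t = (\<Sum>p\<in>K. \<phi> p t *\<^sub>R val v p)" by (simp add: z_def)
    also have "\<dots> = (\<Sum>p\<in>L. \<phi> p t *\<^sub>R \<Phi> (z v) p)"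
      using K(1) L off val_fix by (intro sum.mono_neutral_cong_right) auto
    finally have "z v t = (\<Sum>p\<in>L. \<phi> p t *\<^sub>R \<Phi> (z v) p)" .
    moreover have "(\<Sum>p\<in>L. \<phi> p t) = 1"
      using \<phi>1[OF t] sum.mono_neutral_right[OF K(1) L(2), of "\<lambda>p. \<phi> p t"] off by auto
    ultimately show ?thesis
      using L(1) K(2) \<phi>0[OF t]
      by (simp only:) (intro convex_sum convex_convex_hull hull_inc imageI, auto simp: L_def)
  qed
  then show ?thesis using that z_in[OF v_in] by blast
qed

text \<open>For approximate fixed points \<open>y N\<close> with \<open>\<delta> \<rightarrow> 0\<close>, equicontinuity makes \<open>y N\<close> and \<open>\<Phi> (y N)\<close>
uniformly close, and Arzela-Ascoli makes \<open>\<Phi> (y N)\<close> converge along a subsequence. The common limit is a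
fixed point.\<close>

theorem schauder_equicontinuous:
  fixes \<Phi> :: "('a::euclidean_space \<Rightarrow> 'b::euclidean_space) \<Rightarrow> 'a \<Rightarrow> 'b"
  assumes S: "compact S" and ab: "cbox a b \<noteq> {}"
    and maps: "\<And>x t. x \<in> continuous_into S (cbox a b) \<Longrightarrow> t \<in> S \<Longrightarrow> \<Phi> x t \<in> cbox a b"
    and cont: "\<And>Y x t. (\<And>k::nat. Y k \<in> continuous_into S (cbox a b)) \<Longrightarrow>
        x \<in> continuous_into S (cbox a b) \<Longrightarrow> uniform_limit S Y x sequentially \<Longrightarrow> t \<in> S \<Longrightarrow>
        (\<lambda>k. \<Phi> (Y k) t) \<longlonglongrightarrow> \<Phi> x t"
    and equi: "\<And>\<epsilon>. \<epsilon> > 0 \<Longrightarrow> \<exists>\<delta>>0. \<forall>x \<in> continuous_into S (cbox a b). \<forall>s\<in>S. \<forall>t\<in>S.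
        dist s t < \<delta> \<longrightarrow> dist (\<Phi> x s) (\<Phi> x t) < \<epsilon>"
  obtains x where "x \<in> continuous_into S (cbox a b)" and "\<And>t. t \<in> S \<Longrightarrow> \<Phi> x t = x t"
proof -
  have "\<exists>y. y \<in> continuous_into S (cbox a b) \<and>
        (\<forall>t\<in>S. y t \<in> convex hull (\<Phi> y ` (S \<inter> ball t (inverse (real (Suc N))))))" for N
  proof (rule schauder_approximate_fixed_point[where \<Phi>=\<Phi> and \<delta> = "inverse (real (Suc N))", OF S ab])
    show "inverse (real (Suc N)) > 0" by simp
  qed (use maps cont in blast)+
  then obtain y where y: "\<And>N. y N \<in> continuous_into S (cbox a b)"
    and hull: "\<And>N t. t \<in> S \<Longrightarrow> y N t \<in> convex hull (\<Phi> (y N) ` (S \<inter> ball t (inverse (real (Suc N)))))"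
    by metis
  obtain M where M: "\<And>u. u \<in> cbox a b \<Longrightarrow> norm u \<le> M"
    using bounded_cbox[of a b] by (auto simp: bounded_iff)
  obtain x k where x: "continuous_on S x" and k: "strict_mono (k :: nat \<Rightarrow> nat)"
    and lim: "\<And>e. 0 < e \<Longrightarrow> \<exists>N. \<forall>n t. n \<ge> N \<and> t \<in> S \<longrightarrow> norm (\<Phi> (y (k n)) t - x t) < e"
  proof (rule Arzela_Ascoli[OF S, of "\<lambda>N. \<Phi> (y N)" M])
    fix t and e :: real assume "t \<in> S" "0 < e"
    then show "\<exists>d. 0 < d \<and> (\<forall>n s. s \<in> S \<and> norm (t - s) < d \<longrightarrow> norm (\<Phi> (y n) t - \<Phi> (y n) s) < e)"
      using equi[of e] y unfolding dist_norm by blast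
  qed (use maps y M in blast)+
  have lim': "uniform_limit S (\<lambda>n. \<Phi> (y (k n))) x sequentially"
  proof (rule uniform_limitI)
    fix e :: real assume "e > 0"
    then show "\<forall>\<^sub>F n in sequentially. \<forall>t\<in>S. dist (\<Phi> (y (k n)) t) (x t) < e"
      using lim[of e] by (auto simp: eventually_sequentially dist_norm)
  qed
  have near: "uniform_limit S (\<lambda>n. y (k n)) x sequentially"
  proof (rule uniform_limitI)
    fix e :: real assume e: "e > 0"
    then obtain \<delta> where \<delta>: "\<delta> > 0" and eq: "\<And>N s t. s \<in> S \<Longrightarrow> t \<in> S \<Longrightarrow> dist s t < \<delta> \<Longrightarrow>
        dist (\<Phi> (y N) s) (\<Phi> (y N) t) < e / 2"
      using equi[of "e / 2"] y by (metis half_gt_zero)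
    have "\<forall>\<^sub>F n in sequentially. inverse (real (Suc n)) < \<delta>"
      using LIMSEQ_inverse_real_of_nat \<delta> by (rule order_tendstoD)
    moreover have "\<forall>\<^sub>F n in sequentially. \<forall>t\<in>S. dist (\<Phi> (y (k n)) t) (x t) < e / 2"
      using e by (intro uniform_limitD[OF lim']) simp
    ultimately show "\<forall>\<^sub>F n in sequentially. \<forall>t\<in>S. dist (y (k n) t) (x t) < e"
    proof eventually_elim
      case (elim n)
      show ?case
      proof
        fix t assume t: "t \<in> S"
        have "inverse (real (Suc (k n))) \<le> inverse (real (Suc n))"
          using seq_suble[OF k, of n] by (simp add: field_simps)
        then have "inverse (real (Suc (k n))) < \<delta>" using elim(1) by linarith
        then have "\<Phi> (y (k n)) s \<in> ball (\<Phi> (y (k n)) t) (e / 2)"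
          if "s \<in> S \<inter> ball t (inverse (real (Suc (k n))))" for s
          using eq[of t s "k n"] t that by (simp del: of_nat_Suc)
        then have "\<Phi> (y (k n)) ` (S \<inter> ball t (inverse (real (Suc (k n))))) \<subseteq> ball (\<Phi> (y (k n)) t) (e / 2)"
          by blast
        then have "y (k n) t \<in> ball (\<Phi> (y (k n)) t) (e / 2)"
          using hull[OF t, of "k n"] hull_minimal[of _ "ball (\<Phi> (y (k n)) t) (e / 2)" convex]
          by blast
        then have "dist (y (k n) t) (\<Phi> (y (k n)) t) < e / 2" by (simp add: dist_commute)
        with elim(2) t show "dist (y (k n) t) (x t) < e" by (metis dist_triangle_half_r dist_commute)
      qed
    qed
  qed
  have "x t \<in> cbox a b" if "t \<in> S" for t
    by (rule Lim_in_closed_set[OF closed_cbox _ _ tendsto_uniform_limitI[OF lim' that]])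
       (use maps y that in auto)
  then have x_in: "x \<in> continuous_into S (cbox a b)" using x by (auto simp: continuous_into_def)
  have "\<Phi> x t = x t" if t: "t \<in> S" for t
    using LIMSEQ_unique[OF cont[OF y x_in near t] tendsto_uniform_limitI[OF lim' t]] by simp
  with x_in that show ?thesis by blast
qed

section \<open>Krasnoselskii's theorem in a conical annulus\<close>

lemma component_le_l1_norm: "\<bar>x $ i\<bar> \<le> l1_norm x"
  unfolding l1_norm_def by (rule member_le_sum) auto

lemma norm_le_l1_norm: "norm x \<le> l1_norm x"
  unfolding l1_norm_def by (rule norm_le_l1_cart)

lemma l1_norm_scaleR: "l1_norm (c *\<^sub>R x) = \<bar>c\<bar> * l1_norm x"
  by (simp add: l1_norm_def abs_mult sum_distrib_left)

lemma l1_norm_pos_iff: "0 < l1_norm x \<longleftrightarrow> x \<noteq> 0"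
proof
  show "0 < l1_norm x \<Longrightarrow> x \<noteq> 0" by (auto simp: l1_norm_def)
  show "x \<noteq> 0 \<Longrightarrow> 0 < l1_norm x" using norm_le_l1_norm[of x] zero_less_norm_iff[of x] by linarith
qed

lemma l1_norm_of_nonneg: "(\<And>i. 0 \<le> x $ i) \<Longrightarrow> l1_norm x = (\<Sum>i\<in>UNIV. x $ i)"
  by (simp add: l1_norm_def)

lemma continuous_on_l1_norm [continuous_intros]:
  "continuous_on S h \<Longrightarrow> continuous_on S (\<lambda>t. l1_norm (h t))"
  unfolding l1_norm_def by (intro continuous_intros)

lemma tendsto_l1_norm [tendsto_intros]:
  "(h \<longlongrightarrow> l) F \<Longrightarrow> ((\<lambda>t. l1_norm (h t)) \<longlongrightarrow> l1_norm l) F"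
  unfolding l1_norm_def by (intro tendsto_intros)

definition annular_cone :: "real \<Rightarrow> real \<Rightarrow> (real ^ 'n) set" where
  "annular_cone c C = {z. (\<forall>i. 0 \<le> z $ i) \<and> c \<le> l1_norm z \<and> l1_norm z \<le> C}"

text \<open>A continuous retraction of the nonnegative orthant onto its part where the \<open>l1_norm\<close> is at least
\<open>c\<close>: missing mass is distributed evenly over the components. It lets an operator that is only
defined away from the origin act on a whole cube.\<close>

definition lift_off :: "real \<Rightarrow> real ^ 'n \<Rightarrow> real ^ 'n" where
  "lift_off c u = u + (max 0 (c - l1_norm u) / real CARD('n)) *\<^sub>R 1"

lemma lift_off_id: "c \<le> l1_norm u \<Longrightarrow> lift_off c u = u"
  by (simp add: lift_off_def)

lemma lift_off_nonneg: "(\<And>i. 0 \<le> u $ i) \<Longrightarrow> 0 \<le> lift_off c u $ i"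
  by (simp add: lift_off_def)

lemma l1_norm_lift_off:
  fixes u :: "real ^ 'n"
  assumes "\<And>i. 0 \<le> u $ i"
  shows "l1_norm (lift_off c u) = max c (l1_norm u)"
proof -
  have "l1_norm (lift_off c u) = (\<Sum>i\<in>UNIV. u $ i + max 0 (c - l1_norm u) / real CARD('n))"
    using lift_off_nonneg[OF assms] by (simp add: l1_norm_of_nonneg) (simp add: lift_off_def)
  also have "\<dots> = l1_norm u + max 0 (c - l1_norm u)"
    by (simp add: sum.distrib l1_norm_of_nonneg[OF assms])
  finally show ?thesis by simp
qed

text \<open>Size is measured by \<open>l1_norm (x t0)\<close>, which the Harnack inequality makes comparable with \<open>l1_norm (x t)\<close> for all \<open>t\<close> on the range of \<open>F\<close>. Schauder's
theorem is applied to pairs \<open>(u, \<rho>)\<close> of a direction and a size, \<open>x = \<rho> u\<close>, with the map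
\<open>u \<mapsto> F x / l1_norm (F x t0)\<close> and \<open>\<rho> \<mapsto> \<rho> + \<tau> (l1_norm (F x t0) - \<rho>)\<close> truncated to \<open>{r..R}\<close>. At a fixed
pair, \<open>x\<close> is the multiple of \<open>F x\<close> that has size \<open>\<rho>\<close>. If \<open>\<rho>\<close> is interior, the truncation is idle and
the sizes of \<open>x\<close> and \<open>F x\<close> agree; if \<open>\<rho>\<close> is an endpoint, the boundary condition there leaves
equality as the only possibility.

For \<open>\<tau> = 1\<close> the boundary conditions are those of cone compression, for \<open>\<tau> = -1\<close> those of cone
expansion. Equicontinuity is stated relative to the size of the image because only normalised
images enter the argument.\<close>

theorem krasnoselskii_annulus:
  fixes F :: "('a::euclidean_space \<Rightarrow> real ^ 'n) \<Rightarrow> 'a \<Rightarrow> real ^ 'n"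
  assumes S: "compact S" and t0: "t0 \<in> S" and \<sigma>: "0 < \<sigma>" and rR: "0 < r" "r \<le> R"
    and nonneg: "\<And>c C x t i. 0 < c \<Longrightarrow> x \<in> continuous_into S (annular_cone c C) \<Longrightarrow> t \<in> S \<Longrightarrow>
        0 \<le> F x t $ i"
    and nonzero: "\<And>c C x. 0 < c \<Longrightarrow> x \<in> continuous_into S (annular_cone c C) \<Longrightarrow>
        0 < l1_norm (F x t0)"
    and harnack: "\<And>c C x t. 0 < c \<Longrightarrow> x \<in> continuous_into S (annular_cone c C) \<Longrightarrow> t \<in> S \<Longrightarrow>
        \<sigma> * l1_norm (F x t0) \<le> l1_norm (F x t) \<and> \<sigma> * l1_norm (F x t) \<le> l1_norm (F x t0)"
    and cont: "\<And>c C Y x t. 0 < c \<Longrightarrow> (\<And>k::nat. Y k \<in> continuous_into S (annular_cone c C)) \<Longrightarrow>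
        x \<in> continuous_into S (annular_cone c C) \<Longrightarrow> uniform_limit S Y x sequentially \<Longrightarrow> t \<in> S \<Longrightarrow>
        (\<lambda>k. F (Y k) t) \<longlonglongrightarrow> F x t"
    and equi: "\<And>c C \<epsilon>. 0 < c \<Longrightarrow> 0 < \<epsilon> \<Longrightarrow> \<exists>\<delta>>0. \<forall>x \<in> continuous_into S (annular_cone c C).
        \<forall>s\<in>S. \<forall>t\<in>S. dist s t < \<delta> \<longrightarrow> norm (F x s - F x t) \<le> \<epsilon> * l1_norm (F x t0)"
    and \<tau>: "\<tau> = 1 \<or> \<tau> = -1"
    and inner: "\<And>x. x \<in> continuous_into S (annular_cone (\<sigma> * r) (r / \<sigma>)) \<Longrightarrow> l1_norm (x t0) = r \<Longrightarrow>
        0 \<le> \<tau> * (l1_norm (F x t0) - r)"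
    and outer: "\<And>x. x \<in> continuous_into S (annular_cone (\<sigma> * R) (R / \<sigma>)) \<Longrightarrow> l1_norm (x t0) = R \<Longrightarrow>
        \<tau> * (l1_norm (F x t0) - R) \<le> 0"
  obtains x \<rho> where "r \<le> \<rho>" "\<rho> \<le> R" "l1_norm (x t0) = \<rho>"
    "x \<in> continuous_into S (annular_cone (\<sigma> * \<rho>) (\<rho> / \<sigma>))" "\<And>t. t \<in> S \<Longrightarrow> F x t = x t"
proof -
  \<comment> \<open>Pairs \<open>(u, \<rho>)\<close>: normalised images have components between \<open>0\<close> and \<open>1 / \<sigma>\<close> by the Harnack inequality.\<close>
  define B :: "((real ^ 'n) \<times> real) set" where "B = cbox (0, r) (vec (1 / \<sigma>), R)"
  have B: "p \<in> B \<longleftrightarrow> (\<forall>i. 0 \<le> fst p $ i \<and> fst p $ i \<le> 1 / \<sigma>) \<and> r \<le> snd p \<and> snd p \<le> R" for p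
    unfolding B_def by (cases p) (auto simp: cbox_Pair_eq mem_box_cart)
  \<comment> \<open>\<open>h (u, \<rho>) = \<rho> u\<close> as soon as \<open>u\<close> has \<open>l1_norm\<close> at least \<open>\<sigma>\<close>, as normalised images do; otherwise \<open>u\<close> is lifted off the origin first.\<close>
  define h :: "(real ^ 'n) \<times> real \<Rightarrow> real ^ 'n" where "h p = snd p *\<^sub>R lift_off \<sigma> (fst p)" for p
  define C where "C = R * (\<sigma> + real CARD('n) / \<sigma>)"
  have h_cont: "continuous_on B h"
    unfolding h_def lift_off_def by (intro continuous_intros) simp
  have h_in: "h p \<in> annular_cone (\<sigma> * r) C" if "p \<in> B" for p
  proof -
    have p: "\<And>i. 0 \<le> fst p $ i" "\<And>i. fst p $ i \<le> 1 / \<sigma>" "r \<le> snd p" "snd p \<le> R"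
      using that by (auto simp: B)
    have l: "l1_norm (h p) = snd p * max \<sigma> (l1_norm (fst p))"
      using l1_norm_lift_off[OF p(1)] p rR by (simp add: h_def l1_norm_scaleR)
    have "l1_norm (fst p) \<le> real CARD('n) * (1 / \<sigma>)"
      unfolding l1_norm_of_nonneg[OF p(1)] by (rule sum_bounded_above) (rule p)
    moreover have "0 \<le> real CARD('n) / \<sigma>" using \<sigma> by simp
    ultimately have "max \<sigma> (l1_norm (fst p)) \<le> \<sigma> + real CARD('n) / \<sigma>" using \<sigma> by (simp add: max_def)
    then have "l1_norm (h p) \<le> C"
      unfolding l C_def using p rR \<sigma> by (intro mult_mono) auto
    moreover have "\<sigma> * r \<le> l1_norm (h p)"
      unfolding l using p rR \<sigma> by (subst mult.commute) (intro mult_mono; simp)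
    moreover have "0 \<le> h p $ i" for i
      using lift_off_nonneg[OF p(1)] p rR by (simp add: h_def)
    ultimately show ?thesis by (simp add: annular_cone_def)
  qed
  define X where "X y t = h (y t)" for y :: "'a \<Rightarrow> (real ^ 'n) \<times> real" and t
  have X_in: "X y \<in> continuous_into S (annular_cone (\<sigma> * r) C)" if "y \<in> continuous_into S B" for y
  proof -
    have "continuous_on S (X y)"
      unfolding X_def using that by (intro continuous_on_compose2[OF h_cont]) (auto simp: continuous_into_def)
    moreover have "h (y t) \<in> annular_cone (\<sigma> * r) C" if "t \<in> S" for t
      using \<open>y \<in> continuous_into S B\<close> that by (intro h_in) (auto simp: continuous_into_def)
    ultimately show ?thesis by (auto simp: continuous_into_def X_def)
  qed
  have c: "0 < \<sigma> * r" using \<sigma> rR by simp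
  define L where "L y = l1_norm (F (X y) t0)" for y
  \<comment> \<open>The second component does not depend on \<open>t\<close>: the size is carried along as a constant function.\<close>
  define \<Phi> where "\<Phi> y t = (inverse (L y) *\<^sub>R F (X y) t, max r (min R (snd (y t0) + \<tau> * (L y - snd (y t0)))))" for y t
  have L_pos: "0 < L y" if "y \<in> continuous_into S B" for y
    unfolding L_def using nonzero[OF c X_in[OF that]] .
  have L_bd: "\<sigma> * L y \<le> l1_norm (F (X y) t)" "l1_norm (F (X y) t) \<le> L y / \<sigma>"
    if "y \<in> continuous_into S B" "t \<in> S" for y t
    using harnack[OF c X_in that(2)] that \<sigma> unfolding L_def by (auto simp: field_simps)
  have maps: "\<Phi> y t \<in> B" if y: "y \<in> continuous_into S B" and t: "t \<in> S" for y t
  proof -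
    have "F (X y) t $ i \<le> L y / \<sigma>" for i
      using component_le_l1_norm[of "F (X y) t" i] L_bd(2)[OF y t] by linarith
    then have "inverse (L y) * F (X y) t $ i \<le> 1 / \<sigma>" for i
      using L_pos[OF y] \<sigma> by (simp add: field_simps)
    then show ?thesis using nonneg[OF c X_in[OF y] t] L_pos[OF y] rR by (auto simp: B \<Phi>_def)
  qed
  obtain y where y: "y \<in> continuous_into S B" and y_fix: "\<And>t. t \<in> S \<Longrightarrow> \<Phi> y t = y t"
  proof (rule schauder_equicontinuous[OF S, of "(0, r)" "(vec (1 / \<sigma>), R)" \<Phi>, folded B_def])
    show "B \<noteq> {}" using B[of "(0, r)"] \<sigma> rR by auto
    show "\<Phi> x t \<in> B" if "x \<in> continuous_into S B" "t \<in> S" for x t using maps that .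
    fix Y x t assume Y: "\<And>k::nat. Y k \<in> continuous_into S B" and x: "x \<in> continuous_into S B"
      and lim: "uniform_limit S Y x sequentially" and t: "t \<in> S"
    have "uniform_limit S (\<lambda>k. X (Y k)) (X x) sequentially"
      unfolding X_def B_def using Y h_cont compact_cbox
      by (intro uniform_limit_compose_uniformly_continuous_on[OF lim, of B] compact_uniformly_continuous
          always_eventually) (auto simp: B_def continuous_into_def compact_imp_closed)
    then have FX: "(\<lambda>k. F (X (Y k)) s) \<longlonglongrightarrow> F (X x) s" if "s \<in> S" for s
      using cont[OF c, of "\<lambda>k. X (Y k)"] X_in Y x that by blast
    have L: "(\<lambda>k. L (Y k)) \<longlonglongrightarrow> L x"
      unfolding L_def by (intro tendsto_intros FX t0)
    have "(\<lambda>k. Y k t0) \<longlonglongrightarrow> x t0" using tendsto_uniform_limitI[OF lim t0] .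
    then show "(\<lambda>k. \<Phi> (Y k) t) \<longlonglongrightarrow> \<Phi> x t"
      unfolding \<Phi>_def using L_pos[OF x] by (intro tendsto_intros FX L t) auto
  next
    fix \<epsilon> :: real assume \<epsilon>: "0 < \<epsilon>"
    then obtain \<delta> where \<delta>: "\<delta> > 0" and eq: "\<And>x s t. x \<in> continuous_into S (annular_cone (\<sigma> * r) C) \<Longrightarrow>
        s \<in> S \<Longrightarrow> t \<in> S \<Longrightarrow> dist s t < \<delta> \<Longrightarrow> norm (F x s - F x t) \<le> \<epsilon> / 2 * l1_norm (F x t0)"
      using equi[OF c half_gt_zero[OF \<epsilon>], of C] by blast
    show "\<exists>\<delta>>0. \<forall>x \<in> continuous_into S B. \<forall>s\<in>S. \<forall>t\<in>S. dist s t < \<delta> \<longrightarrow> dist (\<Phi> x s) (\<Phi> x t) < \<epsilon>"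
    proof (intro exI[of _ \<delta>] conjI \<delta> ballI impI)
      fix x s t assume x: "x \<in> continuous_into S B" and st: "s \<in> S" "t \<in> S" "dist s t < \<delta>"
      have "dist (\<Phi> x s) (\<Phi> x t) = norm (inverse (L x) *\<^sub>R (F (X x) s - F (X x) t))"
        by (simp add: \<Phi>_def dist_Pair_Pair dist_norm scaleR_diff_right)
      also have "\<dots> \<le> inverse (L x) * (\<epsilon> / 2 * L x)"
        using eq[OF X_in[OF x] st] L_pos[OF x] by (simp add: L_def[symmetric] mult_left_mono)
      also have "\<dots> < \<epsilon>" using L_pos[OF x] \<epsilon> by simp
      finally show "dist (\<Phi> x s) (\<Phi> x t) < \<epsilon>" .
    qed
  qed blast
  define x \<rho> where "x = X y" and "\<rho> = snd (y t0)"
  have \<rho>: "r \<le> \<rho>" "\<rho> \<le> R" using y t0 by (auto simp: continuous_into_def B \<rho>_def)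
  have fsty: "fst (y t) = inverse (L y) *\<^sub>R F x t" if "t \<in> S" for t
    using y_fix[OF that] by (simp add: \<Phi>_def x_def prod_eq_iff)
  have clamp: "snd (y t) = max r (min R (\<rho> + \<tau> * (L y - \<rho>)))" if "t \<in> S" for t
    using y_fix[OF that] by (simp add: \<Phi>_def \<rho>_def prod_eq_iff)
  have xt: "x t = (\<rho> / L y) *\<^sub>R F x t" if t: "t \<in> S" for t
  proof -
    have "\<sigma> \<le> l1_norm (fst (y t))"
      using L_bd(1)[OF y t] L_pos[OF y] by (simp add: fsty[OF t] l1_norm_scaleR x_def field_simps)
    moreover have "snd (y t) = \<rho>"
      unfolding \<rho>_def by (rule trans[OF clamp[OF t] clamp[OF t0, symmetric]])
    ultimately have "x t = \<rho> *\<^sub>R fst (y t)" by (simp add: x_def X_def h_def lift_off_id)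
    then show ?thesis using fsty[OF t] by (simp add: divide_inverse)
  qed
  have L: "L y = l1_norm (F x t0)" by (simp add: L_def x_def)
  have xt0: "l1_norm (x t0) = \<rho>"
    using xt[OF t0] L_pos[OF y] rR \<rho> by (metis L abs_of_pos divide_pos_pos l1_norm_scaleR less_le_trans nonzero_eq_divide_eq order_less_irrefl)
  have x_in: "x \<in> continuous_into S (annular_cone (\<sigma> * \<rho>) (\<rho> / \<sigma>))"
  proof -
    have "x t \<in> annular_cone (\<sigma> * \<rho>) (\<rho> / \<sigma>)" if t: "t \<in> S" for t
    proof -
      have "l1_norm (x t) = \<rho> / L y * l1_norm (F x t)"
        using xt[OF t] \<rho> rR L_pos[OF y] by (metis abs_of_nonneg divide_nonneg_pos l1_norm_scaleR less_le_trans order_less_imp_le)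
      moreover have "\<rho> / L y * (\<sigma> * L y) \<le> \<rho> / L y * l1_norm (F x t)"
        "\<rho> / L y * l1_norm (F x t) \<le> \<rho> / L y * (L y / \<sigma>)"
        using L_bd[OF y t] \<rho> rR L_pos[OF y] by (intro mult_left_mono; simp add: x_def)+
      ultimately have "\<sigma> * \<rho> \<le> l1_norm (x t)" "l1_norm (x t) \<le> \<rho> / \<sigma>"
        using L_pos[OF y] by (simp_all add: mult.commute)
      moreover have "x t \<in> annular_cone (\<sigma> * r) C"
        using X_in[OF y] t by (auto simp: x_def continuous_into_def)
      ultimately show ?thesis by (simp add: annular_cone_def)
    qed
    then show ?thesis using X_in[OF y] by (auto simp: x_def continuous_into_def)
  qed
  have "L y = \<rho>"
  proof -
    define v where "v = \<rho> + \<tau> * (L y - \<rho>)"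
    have v: "\<rho> = max r (min R v)" using clamp[OF t0] by (simp only: v_def \<rho>_def)
    have "\<rho> = r \<Longrightarrow> r \<le> v" using inner[of x] x_in xt0 by (auto simp: v_def L)
    moreover have "\<rho> = R \<Longrightarrow> v \<le> R" using outer[of x] x_in xt0 by (auto simp: v_def L)
    ultimately have "v = \<rho>" using v rR unfolding max_def min_def by (smt (verit))
    then show ?thesis using \<tau> by (auto simp: v_def)
  qed
  then have "F x t = x t" if "t \<in> S" for t using xt[OF that] L_pos[OF y] by simp
  with \<rho> xt0 x_in that show ?thesis by blast
qed

section \<open>Periodic extension and Green functions\<close>

definition periodic_extension :: "real \<Rightarrow> (real \<Rightarrow> 'a) \<Rightarrow> real \<Rightarrow> 'a" where
  "periodic_extension T x t = x (t - of_int \<lfloor>t / T\<rfloor> * T)"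

lemma periodic_extension_argument:
  assumes "0 < T"
  shows "t - of_int \<lfloor>t / T\<rfloor> * T \<in> {0..<T}"
proof -
  have "of_int \<lfloor>t / T\<rfloor> \<le> t / T" "t / T < of_int \<lfloor>t / T\<rfloor> + 1" by linarith+
  then have "of_int \<lfloor>t / T\<rfloor> * T \<le> t" "t < (of_int \<lfloor>t / T\<rfloor> + 1) * T"
    using assms by (simp_all only: pos_le_divide_eq pos_divide_less_eq)
  then show ?thesis by (simp add: algebra_simps)
qed

lemma periodic_extension_periodic:
  assumes "0 < T"
  shows "periodic_fun_simple (periodic_extension T x) T"
proof
  fix t
  have "\<lfloor>(t + T) / T\<rfloor> = \<lfloor>t / T\<rfloor> + 1" using assms by (simp add: add_divide_distrib)
  then show "periodic_extension T x (t + T) = periodic_extension T x t"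
    by (simp add: periodic_extension_def algebra_simps)
qed

lemma periodic_extension_shift:
  assumes T: "0 < T" and x: "x 0 = x T" and t: "t \<in> {of_int k * T..of_int (k + 1) * T}"
  shows "periodic_extension T x t = x (t - of_int k * T)"
proof (cases "t = of_int (k + 1) * T")
  case True
  then have "\<lfloor>t / T\<rfloor> = k + 1" using T by simp
  with True show ?thesis using x by (simp add: periodic_extension_def algebra_simps)
next
  case False
  then have "\<lfloor>t / T\<rfloor> = k" using T t by (intro floor_unique) (auto simp: field_simps)
  then show ?thesis by (simp add: periodic_extension_def)
qed

lemma periodic_extension_eq:
  assumes "0 < T" "x 0 = x T" "t \<in> {0..T}"
  shows "periodic_extension T x t = x t"
  using periodic_extension_shift[of T x t 0] assms by simp

text \<open>Near any point the extension is glued from two translates of \<open>x\<close> on adjacent closed intervals, and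
every real number is interior to the union of two such intervals.\<close>

lemma periodic_extension_continuous:
  fixes x :: "real \<Rightarrow> 'a::topological_space"
  assumes T: "0 < T" and x: "x 0 = x T" and cont: "continuous_on {0..T} x"
  shows "continuous_on UNIV (periodic_extension T x)"
proof -
  have piece: "continuous_on {of_int k * T..of_int (k + 1) * T} (periodic_extension T x)" for k :: int
  proof -
    have "continuous_on {of_int k * T..of_int (k + 1) * T} (\<lambda>t. x (t - of_int k * T))"
      by (intro continuous_on_compose2[OF cont] continuous_intros) (auto simp: algebra_simps)
    then show ?thesis
      by (rule continuous_on_cong[THEN iffD1, rotated -1]) (simp_all add: periodic_extension_shift[OF T x])
  qed
  have "isCont (periodic_extension T x) t" for t
  proof -
    define k where "k = \<lfloor>t / T\<rfloor>"
    let ?I = "{of_int (k - 1) * T..of_int k * T} \<union> {of_int k * T..of_int (k + 1) * T}"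
    have "continuous_on ?I (periodic_extension T x)"
      using piece[of "k - 1"] piece[of k] by (intro continuous_on_closed_Un) simp_all
    moreover have "t \<in> interior ?I"
    proof (rule interiorI[of "{of_int (k - 1) * T<..<of_int (k + 1) * T}"])
      show "t \<in> {of_int (k - 1) * T<..<of_int (k + 1) * T}"
        using periodic_extension_argument[OF T, of t] T by (auto simp: k_def[symmetric] algebra_simps)
    qed auto
    ultimately show ?thesis using continuous_on_interior by blast
  qed
  then show ?thesis by (simp add: continuous_on_eq_continuous_at)
qed

lemma periodic_eqI:
  fixes x y :: "real \<Rightarrow> 'a"
  assumes T: "0 < T" and "periodic_fun_simple x T" "periodic_fun_simple y T"
    and eq: "\<And>t. t \<in> {0..T} \<Longrightarrow> x t = y t"
  shows "x t = y t"
proof -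
  interpret x: periodic_fun_simple x T by fact
  interpret y: periodic_fun_simple y T by fact
  have "x t = x (t - of_int \<lfloor>t / T\<rfloor> * T)" "y t = y (t - of_int \<lfloor>t / T\<rfloor> * T)"
    by (simp_all add: x.minus_of_int y.minus_of_int)
  then show ?thesis using eq periodic_extension_argument[OF T, of t] by auto
qed

lemma continuous_on_slice:
  assumes "continuous_on (A \<times> B) (\<lambda>(t, s). K t s)" "t \<in> A"
  shows "continuous_on B (K t)"
  using continuous_on_compose2[OF assms(1) continuous_on_Pair[OF continuous_on_const continuous_on_id],
      of t B] assms(2) by (simp add: image_subset_iff)

text \<open>A Green function inherits the periodic boundary condition from the solutions it represents: for
every periodic right-hand side \<open>h\<close>, the functions \<open>G 0\<close> and \<open>G T\<close> have the same integral against
\<open>h\<close>. Testing with \<open>h s = (G 0 s - G T s) s (T - s)\<close>, whose factor \<open>s (T - s)\<close> makes it vanish at both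
ends and hence extend to a continuous periodic function, gives \<open>G 0 = G T\<close> in the interior of the
interval, and on all of it by continuity.

This is what makes fixed points of the integral operator periodic: \<open>x 0 = x T\<close> holds for
every \<open>x t = \<integral> G t s h s ds\<close>, even if \<open>h\<close> itself does not match at the two ends.\<close>

lemma green_function_endpoints:
  assumes T: "0 < T" and G: "is_green_function T a G" and s: "s \<in> {0..T}"
  shows "G 0 s = G T s"
proof -
  define D where "D s = G 0 s - G T s" for s
  define h where "h s = D s * (s * (T - s))" for s
  have contG: "continuous_on ({0..T} \<times> {0..T}) (\<lambda>(t, s). G t s)"
    using G by (simp add: is_green_function_def)
  note slice = continuous_on_slice[OF contG]
  have D: "continuous_on {0..T} D"
    unfolding D_def using T by (intro continuous_intros slice) auto
  have h: "continuous_on {0..T} h" unfolding h_def by (intro continuous_intros D)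
  define H where "H = periodic_extension T h"
  have H_eq: "H s = h s" if "s \<in> {0..T}" for s
    unfolding H_def using T that by (intro periodic_extension_eq) (auto simp: h_def)
  have "continuous_on UNIV H" "periodic_fun_simple H T"
    unfolding H_def using T h by (auto intro!: periodic_extension_continuous periodic_extension_periodic simp: h_def)
  then obtain w where w: "scalar_periodic_solution T a H w"
    and w_eq: "\<And>t. t \<in> {0..T} \<Longrightarrow> w t = integral {0..T} (\<lambda>s. G t s * H s)"
    using G unfolding is_green_function_def by blast
  have "w (0 + T) = w 0"
    using w unfolding scalar_periodic_solution_def by (blast dest: periodic_fun_simple.plus_period)
  then have "integral {0..T} (\<lambda>s. G T s * H s) = integral {0..T} (\<lambda>s. G 0 s * H s)"
    using w_eq[of 0] w_eq[of T] T by simp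
  moreover have "integral {0..T} (\<lambda>s. G t s * H s) = integral {0..T} (\<lambda>s. G t s * h s)" for t
    by (rule integral_cong) (simp add: H_eq)
  moreover have "(\<lambda>s. G t s * h s) integrable_on {0..T}" if "t \<in> {0..T}" for t
    by (intro integrable_continuous_interval continuous_intros slice h that)
  ultimately have "integral {0..T} (\<lambda>s. D s * h s) = 0"
    using T by (simp add: D_def left_diff_distrib integral_diff)
  moreover have "continuous_on {0..T} (\<lambda>s. D s * h s)" by (intro continuous_intros D h)
  moreover have "D s * h s = (D s)\<^sup>2 * (s * (T - s))" for s
    by (simp add: h_def power2_eq_square)
  ultimately have zero: "\<forall>s\<in>{0..T}. (D s)\<^sup>2 * (s * (T - s)) = 0"
    using integral_eq_0_iff[of 0 T "\<lambda>s. D s * h s"] T by simp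
  then have "D u = 0" if "u \<in> {0<..<T}" for u
    using bspec[OF zero, of u] that by auto
  then have "D s = 0"
    using continuous_constant_on_closure[of "{0<..<T}" D 0 s] D s T by simp
  then show ?thesis by (simp add: D_def)
qed

lemma vec_has_vector_derivative:
  fixes w :: "'n::finite \<Rightarrow> real \<Rightarrow> real"
  assumes "\<And>i. (w i has_vector_derivative w' i) F"
  shows "((\<lambda>t. \<chi> i. w i t) has_vector_derivative (\<chi> i. w' i)) F"
proof -
  have expand: "(\<chi> i. v i) = (\<Sum>i\<in>UNIV. v i *\<^sub>R axis i 1)" for v :: "'n \<Rightarrow> real"
    using basis_expansion[of "\<chi> i. v i"] by (simp add: scalar_mult_eq_scaleR)
  show ?thesis unfolding expand
    by (intro has_vector_derivative_sum bounded_linear.has_vector_derivative[OF bounded_linear_scaleR_left] assms)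
qed

lemma C2_vec:
  fixes w w2 :: "'n::finite \<Rightarrow> real \<Rightarrow> real"
  assumes "\<And>i. C2_with_second_deriv (w i) (w2 i)"
  shows "C2_with_second_deriv (\<lambda>t. \<chi> i. w i t) (\<lambda>t. \<chi> i. w2 i t)"
proof -
  from assms have "\<forall>i. \<exists>x1. (\<forall>t. (w i has_vector_derivative x1 t) (at t)) \<and>
           (\<forall>t. (x1 has_vector_derivative w2 i t) (at t))"
    unfolding C2_with_second_deriv_def by blast
  then obtain w1 where "\<And>i t. (w i has_vector_derivative w1 i t) (at t)"
     "\<And>i t. (w1 i has_vector_derivative w2 i t) (at t)" by metis
  moreover have "continuous_on UNIV (w2 i)" for i
    using assms unfolding C2_with_second_deriv_def by blast
  ultimately show ?thesis
    unfolding C2_with_second_deriv_def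
    by (intro conjI exI[of _ "\<lambda>t. \<chi> i. w1 i t"] allI vec_has_vector_derivative continuous_on_vec_lambda)
qed

section \<open>The integral operator of the system\<close>

lemma compact_annular_cone: "compact (annular_cone c C :: (real ^ 'n) set)"
proof -
  have "annular_cone c C = (\<Inter>i. {z :: real ^ 'n. 0 \<le> z $ i}) \<inter> {z. c \<le> l1_norm z} \<inter> {z. l1_norm z \<le> C}"
    by (auto simp: annular_cone_def)
  moreover have "closed \<dots>"
    by (intro closed_Int closed_INT ballI closed_Collect_le continuous_intros)
  moreover have "bounded (annular_cone c C :: (real ^ 'n) set)"
    unfolding bounded_iff annular_cone_def using norm_le_l1_norm order_trans by blast
  ultimately show ?thesis by (simp add: compact_eq_bounded_closed)
qed

lemma annular_cone_nonzero: "0 < c \<Longrightarrow> z \<in> annular_cone c C \<Longrightarrow> z \<noteq> 0"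
  using l1_norm_pos_iff[of z] by (auto simp: annular_cone_def)

lemma continuous_into_mem: "x \<in> continuous_into S B \<Longrightarrow> s \<in> S \<Longrightarrow> x s \<in> B"
  by (auto simp: continuous_into_def)

text \<open>The constants \<open>m\<close> and \<open>M\<close> are uniform bounds of the Green functions; a positive lower bound exists
because a positive continuous function on a compact square attains its minimum. The parameter
\<open>lam\<close> is not fixed, since the bounds must not depend on it.\<close>

locale green_system =
  fixes T :: real
    and f :: "'n::finite \<Rightarrow> real ^ 'n \<Rightarrow> real"
    and a g e :: "'n \<Rightarrow> real \<Rightarrow> real"
    and G :: "'n \<Rightarrow> real \<Rightarrow> real \<Rightarrow> real"
    and m M :: real
  assumes T_pos: "0 < T"
    and green: "\<And>i. is_green_function T (a i) (G i)"
    and m_pos: "0 < m"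
    and G_lower: "\<And>i t s. t \<in> {0..T} \<Longrightarrow> s \<in> {0..T} \<Longrightarrow> m \<le> G i t s"
    and G_upper: "\<And>i t s. t \<in> {0..T} \<Longrightarrow> s \<in> {0..T} \<Longrightarrow> G i t s \<le> M"
    and f_cont: "\<And>i. continuous_on (UNIV - {0}) (f i)"
    and f_pos: "\<And>i x. x \<noteq> 0 \<Longrightarrow> 0 < f i x"
    and g_cont: "\<And>i. continuous_on UNIV (g i)"
    and e_cont: "\<And>i. continuous_on UNIV (e i)"
    and g_periodic: "\<And>i. periodic_fun_simple (g i) T"
    and e_periodic: "\<And>i. periodic_fun_simple (e i) T"
    and g_nonneg: "\<And>i t. t \<in> {0..T} \<Longrightarrow> 0 \<le> g i t"
    and e_nonneg: "\<And>i t. t \<in> {0..T} \<Longrightarrow> 0 \<le> e i t"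
    and g_int: "\<And>i. 0 < integral {0..T} (g i)"
begin

definition source :: "real \<Rightarrow> (real \<Rightarrow> real ^ 'n) \<Rightarrow> 'n \<Rightarrow> real \<Rightarrow> real" where
  "source lam x i s = lam * g i s * f i (x s) + lam * e i s"

definition green_op :: "real \<Rightarrow> (real \<Rightarrow> real ^ 'n) \<Rightarrow> real \<Rightarrow> real ^ 'n" where
  "green_op lam x t = (\<chi> i. integral {0..T} (\<lambda>s. G i t s * source lam x i s))"

lemma m_le_M: "m \<le> M"
  using G_lower[of 0 0] G_upper[of 0 0] T_pos by (meson atLeastAtMost_iff less_imp_le order_refl order_trans)

lemma G_cont: "continuous_on ({0..T} \<times> {0..T}) (\<lambda>(t, s). G i t s)"
  using green[of i] by (simp add: is_green_function_def)

lemma G_slice: "t \<in> {0..T} \<Longrightarrow> continuous_on {0..T} (G i t)"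
  by (rule continuous_on_slice[OF G_cont])

lemma g_integrable: "g i integrable_on {0..T}" and e_integrable: "e i integrable_on {0..T}"
  by (auto intro!: integrable_continuous_interval continuous_on_subset[OF g_cont] continuous_on_subset[OF e_cont])

context
  fixes lam c C :: real
  assumes lam: "0 < lam" and c: "0 < c"
begin

lemma source_cont:
  assumes "x \<in> continuous_into {0..T} (annular_cone c C)"
  shows "continuous_on {0..T} (source lam x i)"
proof -
  have "continuous_on {0..T} (\<lambda>s. f i (x s))"
    using assms annular_cone_nonzero[OF c]
    by (intro continuous_on_compose2[OF f_cont]) (auto simp: continuous_into_def image_subset_iff)
  then show ?thesis
    unfolding source_def
    by (intro continuous_intros continuous_on_subset[OF g_cont] continuous_on_subset[OF e_cont]) auto
qed

lemma source_nonneg: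
  assumes "x \<in> continuous_into {0..T} (annular_cone c C)" "s \<in> {0..T}"
  shows "0 \<le> source lam x i s"
proof -
  have "0 < f i (x s)"
    using annular_cone_nonzero[OF c continuous_into_mem[OF assms]] by (rule f_pos)
  then show ?thesis using lam g_nonneg e_nonneg assms by (simp add: source_def)
qed

lemma source_integrable:
  assumes "x \<in> continuous_into {0..T} (annular_cone c C)"
  shows "source lam x i integrable_on {0..T}"
  using source_cont[OF assms] by (rule integrable_continuous_interval)

text \<open>Continuity upgrades a vanishing integral of the nonnegative source to a vanishing source, which
would force \<open>g i\<close> to vanish as \<open>f i\<close> is positive; but \<open>g i\<close> has positive mean.\<close>

lemma source_int_pos:
  assumes x: "x \<in> continuous_into {0..T} (annular_cone c C)"
  shows "0 < integral {0..T} (source lam x i)"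
proof (rule ccontr)
  assume "\<not> ?thesis"
  then have "integral {0..T} (source lam x i) = 0"
    using integral_nonneg[OF source_integrable[OF x], of i] source_nonneg[OF x] by fastforce
  then have zero: "\<forall>s\<in>{0..T}. source lam x i s = 0"
    using integral_eq_0_iff[OF source_cont[OF x] T_pos] source_nonneg[OF x] by blast
  have "g i s = 0" if s: "s \<in> {0..T}" for s
  proof -
    have "0 < f i (x s)"
      using annular_cone_nonzero[OF c continuous_into_mem[OF x s]] by (rule f_pos)
    moreover have "lam * g i s * f i (x s) + lam * e i s = 0" using zero s by (simp add: source_def)
    moreover have "0 \<le> lam * g i s * f i (x s)" "0 \<le> lam * e i s"
      using lam g_nonneg[OF s] e_nonneg[OF s] calculation(1) by simp_all
    ultimately have "lam * g i s * f i (x s) = 0" by linarith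
    then show ?thesis using lam \<open>0 < f i (x s)\<close> by simp
  qed
  then have "integral {0..T} (g i) = integral {0..T} (\<lambda>_. 0)" by (intro integral_cong) auto
  then show False using g_int[of i] by simp
qed

lemma product_integrable:
  assumes "x \<in> continuous_into {0..T} (annular_cone c C)" "t \<in> {0..T}"
  shows "(\<lambda>s. G i t s * source lam x i s) integrable_on {0..T}"
  using assms by (intro integrable_continuous_interval continuous_intros G_slice source_cont)

lemma green_op_bounds:
  assumes x: "x \<in> continuous_into {0..T} (annular_cone c C)" and t: "t \<in> {0..T}"
  shows "m * integral {0..T} (source lam x i) \<le> green_op lam x t $ i"
    and "green_op lam x t $ i \<le> M * integral {0..T} (source lam x i)"
proof -
  have "integral {0..T} (\<lambda>s. m * source lam x i s) \<le> integral {0..T} (\<lambda>s. G i t s * source lam x i s)"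
    using G_lower[OF t] source_nonneg[OF x] source_integrable[OF x] product_integrable[OF x t]
    by (intro integral_le mult_right_mono integrable_on_mult_right) auto
  moreover have "integral {0..T} (\<lambda>s. G i t s * source lam x i s) \<le> integral {0..T} (\<lambda>s. M * source lam x i s)"
    using G_upper[OF t] source_nonneg[OF x] source_integrable[OF x] product_integrable[OF x t]
    by (intro integral_le mult_right_mono integrable_on_mult_right) auto
  ultimately show "m * integral {0..T} (source lam x i) \<le> green_op lam x t $ i"
    "green_op lam x t $ i \<le> M * integral {0..T} (source lam x i)"
    by (simp_all add: green_op_def)
qed

lemma green_op_pos:
  assumes x: "x \<in> continuous_into {0..T} (annular_cone c C)" and t: "t \<in> {0..T}"
  shows "0 < green_op lam x t $ i"
  using green_op_bounds(1)[OF x t, of i] mult_pos_pos[OF m_pos source_int_pos[OF x, of i]] by linarith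

lemma l1_green_op_bounds:
  assumes x: "x \<in> continuous_into {0..T} (annular_cone c C)" and t: "t \<in> {0..T}"
  shows "m * (\<Sum>i\<in>UNIV. integral {0..T} (source lam x i)) \<le> l1_norm (green_op lam x t)"
    and "l1_norm (green_op lam x t) \<le> M * (\<Sum>i\<in>UNIV. integral {0..T} (source lam x i))"
proof -
  have l: "l1_norm (green_op lam x t) = (\<Sum>i\<in>UNIV. green_op lam x t $ i)"
    using green_op_pos[OF x t] by (intro l1_norm_of_nonneg) (simp add: less_imp_le)
  show "m * (\<Sum>i\<in>UNIV. integral {0..T} (source lam x i)) \<le> l1_norm (green_op lam x t)"
    "l1_norm (green_op lam x t) \<le> M * (\<Sum>i\<in>UNIV. integral {0..T} (source lam x i))"
    unfolding l sum_distrib_left by (intro sum_mono green_op_bounds[OF x t])+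
qed

text \<open>At every \<open>t\<close>, the size of the image lies between \<open>m\<close> and \<open>M\<close> times the total mass of the source,
and the mass does not depend on \<open>t\<close>.\<close>

lemma green_op_harnack:
  assumes x: "x \<in> continuous_into {0..T} (annular_cone c C)" and s: "s \<in> {0..T}" and t: "t \<in> {0..T}"
  shows "m / M * l1_norm (green_op lam x s) \<le> l1_norm (green_op lam x t)"
proof -
  have M: "0 < M" using m_pos m_le_M by linarith
  have "m / M * l1_norm (green_op lam x s) \<le> m / M * (M * (\<Sum>i\<in>UNIV. integral {0..T} (source lam x i)))"
    using l1_green_op_bounds(2)[OF x s] m_pos M by (intro mult_left_mono) auto
  also have "\<dots> = m * (\<Sum>i\<in>UNIV. integral {0..T} (source lam x i))" using M by simp
  also have "\<dots> \<le> l1_norm (green_op lam x t)" by (rule l1_green_op_bounds(1)[OF x t])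
  finally show ?thesis .
qed

text \<open>Dominated convergence applies because all paths involved take values in one compact annulus, on
which \<open>f i\<close> is bounded.\<close>

lemma green_op_tendsto:
  assumes Y: "\<And>k::nat. Y k \<in> continuous_into {0..T} (annular_cone c C)"
    and x: "x \<in> continuous_into {0..T} (annular_cone c C)"
    and lim: "uniform_limit {0..T} Y x sequentially" and t: "t \<in> {0..T}"
  shows "(\<lambda>k. green_op lam (Y k) t) \<longlonglongrightarrow> green_op lam x t"
proof (rule vec_tendstoI)
  fix i
  let ?A = "annular_cone c C :: (real ^ 'n) set"
  define N where "N = (\<lambda>(s, z). G i t s * (lam * g i s * f i z + lam * e i s))"
  have "continuous_on ({0..T} \<times> ?A) N"
    unfolding N_def split_beta using annular_cone_nonzero[OF c, of _ C]
    by (intro continuous_intros continuous_on_compose2[OF G_slice[OF t]] continuous_on_compose2[OF f_cont]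
        continuous_on_compose2[OF g_cont] continuous_on_compose2[OF e_cont]) auto
  then have "bounded (N ` ({0..T} \<times> ?A))"
    by (intro compact_imp_bounded compact_continuous_image compact_Times compact_annular_cone) auto
  then obtain b where b: "\<And>s z. s \<in> {0..T} \<Longrightarrow> z \<in> ?A \<Longrightarrow> norm (N (s, z)) \<le> b"
    unfolding bounded_iff by blast
  have val: "Y k s \<in> ?A" "x s \<in> ?A" if "s \<in> {0..T}" for k s
    using continuous_into_mem[OF Y that] continuous_into_mem[OF x that] .
  have "(\<lambda>k. integral {0..T} (\<lambda>s. G i t s * source lam (Y k) i s)) \<longlonglongrightarrow>
        integral {0..T} (\<lambda>s. G i t s * source lam x i s)"
  proof (rule dominated_convergence(2)[where h = "\<lambda>_. b"])
    fix s assume s: "s \<in> {0..T}"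
    have "isCont (f i) (x s)"
      using f_cont[of i] annular_cone_nonzero[OF c val(2)[OF s]]
      by (simp add: continuous_on_eq_continuous_at open_delete)
    then have "(\<lambda>k. f i (Y k s)) \<longlonglongrightarrow> f i (x s)"
      using tendsto_uniform_limitI[OF lim s] by (rule isCont_tendsto_compose)
    then show "(\<lambda>k. G i t s * source lam (Y k) i s) \<longlonglongrightarrow> G i t s * source lam x i s"
      unfolding source_def by (intro tendsto_intros)
    show "norm (G i t s * source lam (Y k) i s) \<le> b" for k
      using b[OF s val(1)[OF s, of k]] by (simp add: N_def source_def)
  qed (use product_integrable[OF Y t] in auto)
  then show "(\<lambda>k. green_op lam (Y k) t $ i) \<longlonglongrightarrow> green_op lam x t $ i" by (simp add: green_op_def)
qed

text \<open>The modulus of continuity of the kernel bounds the increments of the image by a multiple of the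
mass of the source, and \<open>l1_norm (green_op lam x 0)\<close> is at least \<open>m\<close> times that mass. Hence the
estimate holds relative to the size of the image, however large \<open>f\<close> is on the annulus.\<close>

lemma green_op_equicontinuous:
  assumes \<epsilon>: "0 < \<epsilon>"
  shows "\<exists>\<delta>>0. \<forall>x \<in> continuous_into {0..T} (annular_cone c C :: (real ^ 'n) set). \<forall>s\<in>{0..T}. \<forall>t\<in>{0..T}.
    dist s t < \<delta> \<longrightarrow> norm (green_op lam x s - green_op lam x t) \<le> \<epsilon> * l1_norm (green_op lam x 0)"
proof -
  have "\<exists>d>0. \<forall>s\<in>{0..T}. \<forall>t\<in>{0..T}. \<forall>u\<in>{0..T}. dist s t < d \<longrightarrow> \<bar>G i s u - G i t u\<bar> < \<epsilon> * m" for i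
  proof -
    have "uniformly_continuous_on ({0..T} \<times> {0..T}) (\<lambda>(t, s). G i t s)"
      using G_cont by (rule compact_uniformly_continuous) (intro compact_Times compact_Icc)
    then obtain d where d: "d > 0" "\<And>p q. p \<in> {0..T} \<times> {0..T} \<Longrightarrow> q \<in> {0..T} \<times> {0..T} \<Longrightarrow> dist q p < d \<Longrightarrow>
        dist (case q of (t, s) \<Rightarrow> G i t s) (case p of (t, s) \<Rightarrow> G i t s) < \<epsilon> * m"
      using mult_pos_pos[OF \<epsilon> m_pos] unfolding uniformly_continuous_on_def by metis
    have "\<bar>G i s u - G i t u\<bar> < \<epsilon> * m"
      if "s \<in> {0..T}" "t \<in> {0..T}" "u \<in> {0..T}" "dist s t < d" for s t u
      using d(2)[of "(t, u)" "(s, u)"] that by (simp add: dist_Pair_Pair dist_real_def)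
    with d(1) show ?thesis by blast
  qed
  then obtain d where d: "\<And>i. d i > 0" "\<And>i s t u. s \<in> {0..T} \<Longrightarrow> t \<in> {0..T} \<Longrightarrow> u \<in> {0..T} \<Longrightarrow>
      dist s t < d i \<Longrightarrow> \<bar>G i s u - G i t u\<bar> < \<epsilon> * m"
    by metis
  define \<delta> where "\<delta> = Min (range d)"
  have \<delta>: "0 < \<delta>" "\<And>i. \<delta> \<le> d i" using d(1) by (auto simp: \<delta>_def)
  show ?thesis
  proof (intro exI[of _ \<delta>] conjI ballI impI \<delta>(1))
    fix x :: "real \<Rightarrow> real ^ 'n" and s t assume x: "x \<in> continuous_into {0..T} (annular_cone c C)"
      and s: "s \<in> {0..T}" and t: "t \<in> {0..T}" and st: "dist s t < \<delta>"
    have comp: "\<bar>(green_op lam x s - green_op lam x t) $ i\<bar> \<le> \<epsilon> * m * integral {0..T} (source lam x i)" for i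
    proof -
      have "(green_op lam x s - green_op lam x t) $ i
          = integral {0..T} (\<lambda>u. (G i s u - G i t u) * source lam x i u)"
        using product_integrable[OF x s] product_integrable[OF x t]
        by (simp add: green_op_def left_diff_distrib integral_diff)
      also have "norm \<dots> \<le> integral {0..T} (\<lambda>u. \<epsilon> * m * source lam x i u)"
      proof (rule integral_norm_bound_integral)
        show "(\<lambda>u. (G i s u - G i t u) * source lam x i u) integrable_on {0..T}"
          using product_integrable[OF x s] product_integrable[OF x t]
          by (simp add: left_diff_distrib integrable_diff)
        show "(\<lambda>u. \<epsilon> * m * source lam x i u) integrable_on {0..T}"
          by (intro integrable_on_mult_right source_integrable x)
        fix u assume u: "u \<in> {0..T}"
        have "dist s t < d i" using st \<delta>(2)[of i] by linarith
        then have "\<bar>G i s u - G i t u\<bar> \<le> \<epsilon> * m" using d(2)[OF s t u] by (simp add: less_imp_le)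
        then show "norm ((G i s u - G i t u) * source lam x i u) \<le> \<epsilon> * m * source lam x i u"
          using source_nonneg[OF x u, of i] by (simp add: abs_mult mult_right_mono)
      qed
      finally show ?thesis by simp
    qed
    have "norm (green_op lam x s - green_op lam x t) \<le> (\<Sum>i\<in>UNIV. \<epsilon> * m * integral {0..T} (source lam x i))"
      by (rule order_trans[OF norm_le_l1_cart sum_mono]) (rule comp)
    also have "\<dots> = \<epsilon> * (m * (\<Sum>i\<in>UNIV. integral {0..T} (source lam x i)))"
      by (simp add: sum_distrib_left mult.assoc)
    also have "\<dots> \<le> \<epsilon> * l1_norm (green_op lam x 0)"
      using l1_green_op_bounds(1)[OF x, of 0] T_pos \<epsilon> by (intro mult_left_mono) auto
    finally show "norm (green_op lam x s - green_op lam x t) \<le> \<epsilon> * l1_norm (green_op lam x 0)" .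
  qed
qed

end

section \<open>Solutions of prescribed size\<close>

definition harnack_const :: real (\<open>\<sigma>\<close>) where "\<sigma> = m / M"

text \<open>The paths of size \<open>\<rho>\<close>: the value at \<open>0\<close> has \<open>l1_norm\<close> exactly \<open>\<rho>\<close>, and all other values obey the
Harnack inequality relative to it.\<close>

definition shell :: "real \<Rightarrow> (real \<Rightarrow> real ^ 'n) set" where
  "shell \<rho> = {x \<in> continuous_into {0..T} (annular_cone (\<sigma> * \<rho>) (\<rho> / \<sigma>)). l1_norm (x 0) = \<rho>}"

lemma harnack_const_pos: "0 < \<sigma>"
  using m_pos m_le_M by (simp add: harnack_const_def)

lemma shell_bounds:
  assumes "x \<in> shell \<rho>" "s \<in> {0..T}"
  shows "\<sigma> * \<rho> \<le> l1_norm (x s)" "l1_norm (x s) \<le> \<rho> / \<sigma>"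
  using continuous_into_mem[of x "{0..T}" _ s] assms by (force simp: shell_def annular_cone_def)+

text \<open>A fixed point has equal values at both ends because the kernel does, so its periodic extension is
continuous and so is the right-hand side formed with it. The scalar equations with this
right-hand side have unique periodic solutions; these are given by the Green functions, so they
agree with the fixed point on \<open>{0..T}\<close> and, by periodicity, everywhere.\<close>

lemma fixed_point_is_solution:
  assumes lam: "0 < lam" and c: "0 < c" and x: "x \<in> continuous_into {0..T} (annular_cone c C)"
    and fp: "\<And>t. t \<in> {0..T} \<Longrightarrow> green_op lam x t = x t"
  shows "positive_periodic_solution T a g e f lam (periodic_extension T x)"
proof -
  define X where "X = periodic_extension T x"
  have "green_op lam x 0 = green_op lam x T"
    unfolding green_op_def vec_lambda_inject[OF UNIV_I UNIV_I] fun_eq_iff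
    by (intro allI integral_cong) (simp add: green_function_endpoints[OF T_pos green])
  then have x0T: "x 0 = x T" using fp[of 0] fp[of T] T_pos by simp
  have X_eq: "X t = x t" if "t \<in> {0..T}" for t
    unfolding X_def by (rule periodic_extension_eq[OF T_pos x0T that])
  have X_cont: "continuous_on UNIV X"
    unfolding X_def using x by (intro periodic_extension_continuous T_pos x0T) (simp add: continuous_into_def)
  have X_per: "periodic_fun_simple X T"
    unfolding X_def by (rule periodic_extension_periodic[OF T_pos])
  have X_pos: "0 < X t $ i" for t i
  proof -
    have "t - of_int \<lfloor>t / T\<rfloor> * T \<in> {0..T}" using periodic_extension_argument[OF T_pos, of t] by auto
    then show ?thesis
      using green_op_pos[OF lam c x] fp unfolding X_def periodic_extension_def by metis
  qed
  then have X_nz: "X t \<noteq> 0" for t by (metis less_irrefl zero_index)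
  define h where "h i t = lam * g i t * f i (X t) + lam * e i t" for i t
  have h_cont: "continuous_on UNIV (h i)" for i
    unfolding h_def using X_nz
    by (intro continuous_intros g_cont e_cont continuous_on_compose2[OF f_cont X_cont]) auto
  have h_per: "periodic_fun_simple (h i) T" for i
    by standard (simp add: h_def periodic_fun_simple.plus_period[OF g_periodic]
        periodic_fun_simple.plus_period[OF e_periodic] periodic_fun_simple.plus_period[OF X_per])
  have "\<exists>w. scalar_periodic_solution T (a i) (h i) w \<and>
      (\<forall>t\<in>{0..T}. w t = integral {0..T} (\<lambda>s. G i t s * h i s))" for i
    using green[of i] h_cont[of i] h_per[of i] unfolding is_green_function_def by blast
  then obtain w where w: "\<And>i. scalar_periodic_solution T (a i) (h i) (w i)"
    and w_eq: "\<And>i t. t \<in> {0..T} \<Longrightarrow> w i t = integral {0..T} (\<lambda>s. G i t s * h i s)"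
    by metis
  have wX: "w i t = X t $ i" for i t
  proof (rule periodic_eqI[OF T_pos, where y = "\<lambda>t. X t $ i"])
    show "periodic_fun_simple (w i) T" using w[of i] by (simp add: scalar_periodic_solution_def)
    show "periodic_fun_simple (\<lambda>t. X t $ i) T"
      by standard (simp add: periodic_fun_simple.plus_period[OF X_per])
    fix t assume t: "t \<in> {0..T}"
    have "w i t = integral {0..T} (\<lambda>s. G i t s * source lam x i s)"
      unfolding w_eq[OF t] by (rule integral_cong) (simp add: h_def source_def X_eq)
    also have "\<dots> = green_op lam x t $ i" by (simp add: green_op_def)
    finally show "w i t = X t $ i" using fp[OF t] X_eq[OF t] by simp
  qed
  have "\<exists>w2. C2_with_second_deriv (w i) w2 \<and> (\<forall>t. w2 t + a i t * w i t = h i t)" for i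
    using w[of i] by (simp add: scalar_periodic_solution_def)
  then obtain w2 where w2: "\<And>i. C2_with_second_deriv (w i) (w2 i)"
    "\<And>i t. w2 i t + a i t * w i t = h i t"
    by metis
  have "X = (\<lambda>t. \<chi> i. w i t)" by (auto simp: wX)
  then have "C2_with_second_deriv X (\<lambda>t. \<chi> i. w2 i t)" using C2_vec[OF w2(1)] by simp
  then show ?thesis
    unfolding positive_periodic_solution_def X_def[symmetric]
    using X_per X_pos w2(2) by (intro conjI allI exI[of _ "\<lambda>t. \<chi> i. w2 i t"]) (auto simp: h_def wX)
qed

text \<open>Besides the periodic solution, the underlying path and its size are exported: they show later that
two solutions found in adjacent annuli differ.\<close>

theorem solution_in_annulus:
  assumes lam: "0 < lam" and rR: "0 < r" "r \<le> R" and \<tau>: "\<tau> = 1 \<or> \<tau> = -1"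
    and inner: "\<And>x. x \<in> shell r \<Longrightarrow> 0 \<le> \<tau> * (l1_norm (green_op lam x 0) - r)"
    and outer: "\<And>x. x \<in> shell R \<Longrightarrow> \<tau> * (l1_norm (green_op lam x 0) - R) \<le> 0"
  obtains x \<rho> where "r \<le> \<rho>" "\<rho> \<le> R" "x \<in> shell \<rho>" "l1_norm (green_op lam x 0) = \<rho>"
    "positive_periodic_solution T a g e f lam (periodic_extension T x)"
proof -
  have T0: "0 \<in> {0..T}" using T_pos by simp
  obtain x \<rho> where \<rho>: "r \<le> \<rho>" "\<rho> \<le> R" "l1_norm (x 0) = \<rho>"
    and x: "x \<in> continuous_into {0..T} (annular_cone (\<sigma> * \<rho>) (\<rho> / \<sigma>))"
    and fp: "\<And>t. t \<in> {0..T} \<Longrightarrow> green_op lam x t = x t"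
  proof (rule krasnoselskii_annulus[of "{0..T}" 0 \<sigma> r R "green_op lam" \<tau>])
    fix c C and x :: "real \<Rightarrow> real ^ 'n" and t assume c: "0 < c"
      and x: "x \<in> continuous_into {0..T} (annular_cone c C)" and t: "t \<in> {0..T}"
    show "0 \<le> green_op lam x t $ i" for i using green_op_pos[OF lam c x t] by (simp add: less_imp_le)
    show "\<sigma> * l1_norm (green_op lam x 0) \<le> l1_norm (green_op lam x t) \<and>
          \<sigma> * l1_norm (green_op lam x t) \<le> l1_norm (green_op lam x 0)"
      unfolding harnack_const_def using green_op_harnack[OF lam c x] t T0 by blast
  next
    fix c C and x :: "real \<Rightarrow> real ^ 'n" assume c: "0 < c"
      and x: "x \<in> continuous_into {0..T} (annular_cone c C)"
    show "0 < l1_norm (green_op lam x 0)"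
      using green_op_pos[OF lam c x T0] by (metis l1_norm_pos_iff less_irrefl zero_index)
  next
    fix c C t and x :: "real \<Rightarrow> real ^ 'n" and Y :: "nat \<Rightarrow> real \<Rightarrow> real ^ 'n"
    assume "0 < c" "\<And>k. Y k \<in> continuous_into {0..T} (annular_cone c C)"
      "x \<in> continuous_into {0..T} (annular_cone c C)"
      "uniform_limit {0..T} Y x sequentially" "t \<in> {0..T}"
    then show "(\<lambda>k. green_op lam (Y k) t) \<longlonglongrightarrow> green_op lam x t"
      by (rule green_op_tendsto[OF lam])
  qed (use harnack_const_pos rR \<tau> inner outer T0 green_op_equicontinuous[OF lam] in \<open>auto simp: shell_def\<close>)
  have \<rho>_pos: "0 < \<sigma> * \<rho>" using harnack_const_pos \<rho> rR by simp
  show ?thesis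
  proof (rule that[OF \<rho>(1,2)])
    show "x \<in> shell \<rho>" using x \<rho> by (simp add: shell_def)
    show "l1_norm (green_op lam x 0) = \<rho>" using fp[OF T0] \<rho> by simp
    show "positive_periodic_solution T a g e f lam (periodic_extension T x)"
      by (rule fixed_point_is_solution[OF lam \<rho>_pos x fp])
  qed
qed

lemma green_op_lower:
  assumes lam: "0 < lam" and \<rho>: "0 < \<rho>" and x: "x \<in> shell \<rho>"
    and A: "\<And>s. s \<in> {0..T} \<Longrightarrow> A \<le> f i (x s)"
  shows "m * lam * A * integral {0..T} (g i) \<le> l1_norm (green_op lam x 0)"
proof -
  have c: "0 < \<sigma> * \<rho>" using harnack_const_pos \<rho> by simp
  have x': "x \<in> continuous_into {0..T} (annular_cone (\<sigma> * \<rho>) (\<rho> / \<sigma>))" and T0: "0 \<in> {0..T}"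
    using x T_pos by (auto simp: shell_def)
  have "integral {0..T} (\<lambda>s. lam * A * g i s) \<le> integral {0..T} (source lam x i)"
  proof (intro integral_le integrable_on_mult_right g_integrable source_integrable[OF lam c x'])
    fix s assume s: "s \<in> {0..T}"
    have "lam * (g i s * A) \<le> lam * (g i s * f i (x s)) + lam * e i s"
      using lam g_nonneg[OF s] e_nonneg[OF s] A[OF s]
      by (intro add_increasing2 mult_left_mono) auto
    then show "lam * A * g i s \<le> source lam x i s" by (simp add: source_def mult_ac)
  qed
  then have "m * (lam * A * integral {0..T} (g i)) \<le> m * integral {0..T} (source lam x i)"
    using m_pos by simp
  also have "\<dots> \<le> green_op lam x 0 $ i" by (rule green_op_bounds(1)[OF lam c x' T0])
  also have "\<dots> \<le> l1_norm (green_op lam x 0)"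
    using component_le_l1_norm[of "green_op lam x 0" i] by linarith
  finally show ?thesis by (simp add: mult.assoc)
qed

lemma green_op_upper:
  assumes lam: "0 < lam" and \<rho>: "0 < \<rho>" and x: "x \<in> shell \<rho>"
    and A: "\<And>i s. s \<in> {0..T} \<Longrightarrow> f i (x s) \<le> A"
  shows "l1_norm (green_op lam x 0) \<le>
    M * lam * (A * (\<Sum>i\<in>UNIV. integral {0..T} (g i)) + (\<Sum>i\<in>UNIV. integral {0..T} (e i)))"
proof -
  have c: "0 < \<sigma> * \<rho>" using harnack_const_pos \<rho> by simp
  have x': "x \<in> continuous_into {0..T} (annular_cone (\<sigma> * \<rho>) (\<rho> / \<sigma>))" and T0: "0 \<in> {0..T}"
    using x T_pos by (auto simp: shell_def)
  have le: "integral {0..T} (source lam x i) \<le> lam * (A * integral {0..T} (g i) + integral {0..T} (e i))" for i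
  proof -
    have "integral {0..T} (source lam x i) \<le> integral {0..T} (\<lambda>s. lam * (A * g i s + e i s))"
    proof (intro integral_le integrable_on_mult_right integrable_add g_integrable e_integrable
        source_integrable[OF lam c x'])
      fix s assume s: "s \<in> {0..T}"
      have "lam * (g i s * f i (x s) + e i s) \<le> lam * (g i s * A + e i s)"
        using lam g_nonneg[OF s] A[OF s] by (intro mult_left_mono add_right_mono) auto
      then show "source lam x i s \<le> lam * (A * g i s + e i s)" by (simp add: source_def algebra_simps)
    qed
    also have "\<dots> = lam * (A * integral {0..T} (g i) + integral {0..T} (e i))"
      by (simp add: integral_add g_integrable e_integrable integrable_on_mult_right)
    finally show ?thesis .
  qed
  have "l1_norm (green_op lam x 0) \<le> M * (\<Sum>i\<in>UNIV. integral {0..T} (source lam x i))"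
    by (rule l1_green_op_bounds(2)[OF lam c x' T0])
  also have "\<dots> \<le> M * (\<Sum>i\<in>UNIV. lam * (A * integral {0..T} (g i) + integral {0..T} (e i)))"
    using m_pos m_le_M by (intro mult_left_mono sum_mono le) auto
  also have "\<dots> = M * lam * (A * (\<Sum>i\<in>UNIV. integral {0..T} (g i)) + (\<Sum>i\<in>UNIV. integral {0..T} (e i)))"
    by (simp add: sum_distrib_left[symmetric] sum.distrib mult.assoc)
  finally show ?thesis .
qed

text \<open>Near the origin \<open>f i \<ge> 1\<close>, so the image of a small path is at least \<open>m lam\<close> times the integral of
\<open>g i\<close>, a bound that does not shrink with \<open>r\<close>.\<close>

lemma expands_near_zero:
  assumes lam: "0 < lam" and f0: "filterlim (f i) at_top (at 0)"
  shows "\<exists>r0>0. \<forall>r x. 0 < r \<and> r \<le> r0 \<and> x \<in> shell r \<longrightarrow> r \<le> l1_norm (green_op lam x 0)"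
proof -
  have "eventually (\<lambda>z. 1 \<le> f i z) (at 0)" using f0 by (simp add: filterlim_at_top)
  then obtain d where d: "d > 0" "\<And>z. z \<noteq> 0 \<Longrightarrow> norm z < d \<Longrightarrow> 1 \<le> f i z"
    by (auto simp: eventually_at)
  define r0 where "r0 = min (\<sigma> * (d / 2)) (m * lam * integral {0..T} (g i))"
  have "r0 > 0" using d harnack_const_pos m_pos lam g_int by (simp add: r0_def)
  moreover have "r \<le> l1_norm (green_op lam x 0)" if r: "0 < r" "r \<le> r0" and x: "x \<in> shell r" for r x
  proof -
    have "1 \<le> f i (x s)" if s: "s \<in> {0..T}" for s
    proof (rule d(2))
      have "r / \<sigma> \<le> d / 2" using r harnack_const_pos by (simp add: r0_def field_simps)
      then show "norm (x s) < d" using norm_le_l1_norm[of "x s"] shell_bounds(2)[OF x s] d(1) by linarith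
      show "x s \<noteq> 0"
        using shell_bounds(1)[OF x s] mult_pos_pos[OF harnack_const_pos r(1)] l1_norm_pos_iff[of "x s"] by linarith
    qed
    then have "m * lam * 1 * integral {0..T} (g i) \<le> l1_norm (green_op lam x 0)"
      by (intro green_op_lower[OF lam r(1) x])
    then show ?thesis using r by (simp add: r0_def)
  qed
  ultimately show ?thesis by blast
qed

lemma expands_at_infinity_if_superlinear:
  assumes lam: "0 < lam" and f_inf: "filterlim (\<lambda>z. f i z / l1_norm z) at_top (filtercomap l1_norm at_top)"
  shows "\<exists>R0>0. \<forall>R x. R0 \<le> R \<and> x \<in> shell R \<longrightarrow> R \<le> l1_norm (green_op lam x 0)"
proof -
  define I where "I = integral {0..T} (g i)"
  \<comment> \<open>The slope that makes the lower bound of \<open>green_op_lower\<close> on the shell of size \<open>R\<close> equal to \<open>R\<close>.\<close>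
  define A where "A = 1 / (m * lam * \<sigma> * I)"
  have I: "I > 0" unfolding I_def by (rule g_int)
  have A_pos: "A > 0" using m_pos lam harnack_const_pos I by (simp add: A_def)
  have "eventually (\<lambda>z. A \<le> f i z / l1_norm z) (filtercomap l1_norm at_top)"
    using f_inf unfolding filterlim_at_top by blast
  then obtain K where K: "\<And>z. K \<le> l1_norm z \<Longrightarrow> A \<le> f i z / l1_norm z"
    unfolding eventually_filtercomap_at_top_linorder by blast
  define R0 where "R0 = max 1 (K / \<sigma>)"
  have "R \<le> l1_norm (green_op lam x 0)" if R: "R0 \<le> R" and x: "x \<in> shell R" for R x
  proof -
    have R_pos: "0 < R" and RK: "K \<le> \<sigma> * R" using R harnack_const_pos by (auto simp: R0_def field_simps)
    have "A * (\<sigma> * R) \<le> f i (x s)" if s: "s \<in> {0..T}" for s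
    proof -
      have l: "\<sigma> * R \<le> l1_norm (x s)" by (rule shell_bounds[OF x s])
      then have "0 < l1_norm (x s)" using mult_pos_pos[OF harnack_const_pos R_pos] by linarith
      then have "A * l1_norm (x s) \<le> f i (x s)" using K[of "x s"] l RK by (simp add: field_simps)
      moreover have "A * (\<sigma> * R) \<le> A * l1_norm (x s)" using l A_pos by simp
      ultimately show ?thesis by linarith
    qed
    then have "m * lam * (A * (\<sigma> * R)) * I \<le> l1_norm (green_op lam x 0)"
      unfolding I_def by (intro green_op_lower[OF lam R_pos x])
    moreover have "m * lam * (A * (\<sigma> * R)) * I = R"
      using m_pos lam harnack_const_pos I by (simp add: A_def)
    ultimately show ?thesis by simp
  qed
  then show ?thesis by (intro exI[of _ R0]) (auto simp: R0_def)
qed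

lemma contracts_at_infinity_if_sublinear:
  assumes lam: "0 < lam" and f_inf: "\<And>i. ((\<lambda>z. f i z / l1_norm z) \<longlongrightarrow> 0) (filtercomap l1_norm at_top)"
  shows "\<exists>R0>0. \<forall>R x. R0 \<le> R \<and> x \<in> shell R \<longrightarrow> l1_norm (green_op lam x 0) \<le> R"
proof -
  define \<Gamma> E where "\<Gamma> = (\<Sum>i\<in>UNIV. integral {0..T} (g i))" and "E = (\<Sum>i\<in>UNIV. integral {0..T} (e i))"
  \<comment> \<open>This slope makes the \<open>f\<close>-part of the bound in \<open>green_op_upper\<close> equal to \<open>R / 2\<close>; the \<open>e\<close>-part is at most \<open>R / 2\<close> for large \<open>R\<close>.\<close>
  define \<epsilon> where "\<epsilon> = \<sigma> / (2 * M * lam * \<Gamma>)"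
  have \<Gamma>: "\<Gamma> > 0" unfolding \<Gamma>_def using g_int by (intro sum_pos) auto
  have M: "0 < M" using m_pos m_le_M by linarith
  have \<epsilon>: "\<epsilon> > 0" using harnack_const_pos M lam \<Gamma> by (simp add: \<epsilon>_def)
  have "eventually (\<lambda>z. \<forall>i. f i z / l1_norm z < \<epsilon>) (filtercomap l1_norm at_top)"
    using order_tendstoD(2)[OF f_inf \<epsilon>] by (intro eventually_all_finite)
  then obtain K where K: "\<And>z i. K \<le> l1_norm z \<Longrightarrow> f i z / l1_norm z < \<epsilon>"
    unfolding eventually_filtercomap_at_top_linorder by blast
  define R0 where "R0 = max 1 (max (K / \<sigma>) (2 * M * lam * E))"
  have "l1_norm (green_op lam x 0) \<le> R" if R: "R0 \<le> R" and x: "x \<in> shell R" for R x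
  proof -
    have R_pos: "0 < R" and RK: "K \<le> \<sigma> * R" and RE: "2 * M * lam * E \<le> R"
      using R harnack_const_pos by (auto simp: R0_def field_simps)
    have "f i (x s) \<le> \<epsilon> * (R / \<sigma>)" if s: "s \<in> {0..T}" for i s
    proof -
      have l: "\<sigma> * R \<le> l1_norm (x s)" "l1_norm (x s) \<le> R / \<sigma>" by (rule shell_bounds[OF x s])+
      then have "0 < l1_norm (x s)" using mult_pos_pos[OF harnack_const_pos R_pos] by linarith
      then have "f i (x s) < \<epsilon> * l1_norm (x s)" using K[of "x s" i] l RK by (simp add: field_simps)
      moreover have "\<epsilon> * l1_norm (x s) \<le> \<epsilon> * (R / \<sigma>)" using l \<epsilon> by (intro mult_left_mono) auto
      ultimately show ?thesis by linarith
    qed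
    then have "l1_norm (green_op lam x 0) \<le> M * lam * (\<epsilon> * (R / \<sigma>) * \<Gamma> + E)"
      unfolding \<Gamma>_def E_def by (intro green_op_upper[OF lam R_pos x])
    also have "\<dots> = R / 2 + M * lam * E"
      using M lam harnack_const_pos \<Gamma> by (simp add: \<epsilon>_def field_simps)
    also have "\<dots> \<le> R" using RE by (simp add: mult.assoc)
    finally show ?thesis .
  qed
  then show ?thesis by (intro exI[of _ R0]) (auto simp: R0_def)
qed

text \<open>On the unit shell all \<open>f i\<close> are bounded, by compactness, so the image is of the order of \<open>lam\<close>.\<close>

lemma contracts_on_unit_shell_if_small_parameter:
  "\<exists>lam0>0. \<forall>lam x. 0 < lam \<and> lam < lam0 \<and> x \<in> shell 1 \<longrightarrow> l1_norm (green_op lam x 0) < 1"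
proof -
  define \<Gamma> E where "\<Gamma> = (\<Sum>i\<in>UNIV. integral {0..T} (g i))" and "E = (\<Sum>i\<in>UNIV. integral {0..T} (e i))"
  let ?A = "annular_cone \<sigma> (1 / \<sigma>) :: (real ^ 'n) set"
  have "compact (f i ` ?A)" for i
    using annular_cone_nonzero[OF harnack_const_pos, of _ "1 / \<sigma>"]
    by (intro compact_continuous_image compact_annular_cone continuous_on_subset[OF f_cont]) auto
  then have "bounded (\<Union>i. f i ` ?A)" by (intro bounded_UN compact_imp_bounded) auto
  then obtain b where b: "\<And>i z. z \<in> ?A \<Longrightarrow> \<bar>f i z\<bar> \<le> b" by (auto simp: bounded_iff)
  have M: "0 < M" using m_pos m_le_M by linarith
  define D where "D = \<bar>M * (b * \<Gamma> + E)\<bar> + 1"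
  have D: "0 < D" "M * (b * \<Gamma> + E) < D" by (auto simp: D_def)
  have "l1_norm (green_op lam x 0) < 1" if lam: "0 < lam" "lam < 1 / D" and x: "x \<in> shell 1" for lam x
  proof -
    have "f i (x s) \<le> b" if s: "s \<in> {0..T}" for i s
      using b[of "x s" i] continuous_into_mem[OF _ s] x by (force simp: shell_def)
    then have "l1_norm (green_op lam x 0) \<le> M * lam * (b * \<Gamma> + E)"
      unfolding \<Gamma>_def E_def by (intro green_op_upper[OF lam(1) zero_less_one x])
    also have "\<dots> = lam * (M * (b * \<Gamma> + E))" by (simp add: mult_ac)
    also have "\<dots> < lam * D" using lam D by simp
    also have "\<dots> < 1" using lam D by (simp add: field_simps)
    finally show ?thesis .
  qed
  then show ?thesis using D by (intro exI[of _ "1 / D"]) auto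
qed

end

lemma positive_kernels_bounded_below_and_above:
  fixes G :: "'n::finite \<Rightarrow> real \<Rightarrow> real \<Rightarrow> real"
  assumes T: "0 < T" and cont: "\<And>i. continuous_on ({0..T} \<times> {0..T}) (\<lambda>(t, s). G i t s)"
    and pos: "\<And>i t s. t \<in> {0..T} \<Longrightarrow> s \<in> {0..T} \<Longrightarrow> 0 < G i t s"
  obtains m M where "0 < m"
    "\<And>i t s. t \<in> {0..T} \<Longrightarrow> s \<in> {0..T} \<Longrightarrow> m \<le> G i t s \<and> G i t s \<le> M"
proof -
  let ?Q = "{0..T} \<times> {0..T}"
  define K where "K = (\<Union>i. (\<lambda>(t, s). G i t s) ` ?Q)"
  have "compact K"
    unfolding K_def by (intro compact_UN compact_continuous_image cont compact_Times compact_Icc) simp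
  moreover have "K \<noteq> {}" using T by (auto simp: K_def)
  ultimately obtain m M where "m \<in> K" "M \<in> K" "\<And>v. v \<in> K \<Longrightarrow> m \<le> v \<and> v \<le> M"
    using compact_attains_inf[of K] compact_attains_sup[of K] by metis
  moreover have "0 < v" if "v \<in> K" for v using that pos by (auto simp: K_def)
  moreover have "G i t s \<in> K" if "t \<in> {0..T}" "s \<in> {0..T}" for i t s
    using that unfolding K_def by force
  ultimately show ?thesis using that by metis
qed

theorem theorem2p1:
  fixes T :: real
    and f :: "'n::finite \<Rightarrow> real ^ 'n \<Rightarrow> real"
    and a g e :: "'n \<Rightarrow> real \<Rightarrow> real"
    and G :: "'n \<Rightarrow> real \<Rightarrow> real \<Rightarrow> real"
  assumes T_pos: "T > 0"
    and A_green: "\<And>i. is_green_function T (a i) (G i)"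
    and A_pos: "\<And>i t s. t \<in> {0..T} \<Longrightarrow> s \<in> {0..T} \<Longrightarrow> G i t s > 0"
    and H1_cont: "\<And>i. continuous_on (UNIV - {0}) (f i)"
    and H1_pos: "\<And>i x. l1_norm x > 0 \<Longrightarrow> f i x > 0"
    and H2_cont: "\<And>i. continuous_on UNIV (a i)" "\<And>i. continuous_on UNIV (g i)"
      "\<And>i. continuous_on UNIV (e i)"
    and H2_periodic: "\<And>i. periodic_fun_simple (a i) T" "\<And>i. periodic_fun_simple (g i) T"
      "\<And>i. periodic_fun_simple (e i) T"
    and H2_nonneg: "\<And>i t. t \<in> {0..T} \<Longrightarrow> a i t \<ge> 0" "\<And>i t. t \<in> {0..T} \<Longrightarrow> g i t \<ge> 0"
    and H2_int: "\<And>i. integral {0..T} (g i) > 0"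
    and e_nonneg: "\<And>i t. t \<in> {0..T} \<Longrightarrow> e i t \<ge> 0"
    and f_at_0: "\<And>i. filterlim (f i) at_top (at 0)"
  shows
    "((\<forall>i. ((\<lambda>x. f i x / l1_norm x) \<longlongrightarrow> 0) (filtercomap l1_norm at_top)) \<longrightarrow>
        (\<forall>lam>0. \<exists>x. positive_periodic_solution T a g e f lam x)) \<and>
     ((\<forall>i. filterlim (\<lambda>x. f i x / l1_norm x) at_top (filtercomap l1_norm at_top)) \<longrightarrow>
        (\<exists>lam1>0. \<forall>lam. 0 < lam \<and> lam < lam1 \<longrightarrow>
           (\<exists>x y. x \<noteq> y \<and> positive_periodic_solution T a g e f lam x \<and>
                  positive_periodic_solution T a g e f lam y))) \<and>
     (\<exists>lam0>0. \<forall>lam. 0 < lam \<and> lam < lam0 \<longrightarrow>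
        (\<exists>x. positive_periodic_solution T a g e f lam x))"
proof -
  obtain m M where m: "0 < m"
    and mM: "\<And>i t s. t \<in> {0..T} \<Longrightarrow> s \<in> {0..T} \<Longrightarrow> m \<le> G i t s \<and> G i t s \<le> M"
  proof (rule positive_kernels_bounded_below_and_above[OF T_pos, of G])
    show "continuous_on ({0..T} \<times> {0..T}) (\<lambda>(t, s). G i t s)" for i
      using A_green[of i] by (simp add: is_green_function_def)
  qed (use A_pos in blast)+
  interpret green_system T f a g e G m M
    by unfold_locales
       (use assms m mM in \<open>auto simp: l1_norm_pos_iff periodic_fun_simple_def\<close>)
  obtain lam0 where lam0: "0 < lam0"
    and unit: "\<And>lam x. 0 < lam \<Longrightarrow> lam < lam0 \<Longrightarrow> x \<in> shell 1 \<Longrightarrow> l1_norm (green_op lam x 0) < 1"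
    using contracts_on_unit_shell_if_small_parameter by blast
  \<comment> \<open>Compression: sizes increase near zero and decrease on the shell \<open>R\<close>.\<close>
  have small: "\<exists>x \<rho>. \<rho> \<le> R \<and> x \<in> shell \<rho> \<and> l1_norm (green_op lam x 0) = \<rho> \<and>
      positive_periodic_solution T a g e f lam (periodic_extension T x)"
    if lam: "0 < lam" and R: "0 < R" and outer: "\<And>x. x \<in> shell R \<Longrightarrow> l1_norm (green_op lam x 0) \<le> R" for lam R
  proof -
    obtain r0 where r0: "0 < r0" "\<And>r x. 0 < r \<Longrightarrow> r \<le> r0 \<Longrightarrow> x \<in> shell r \<Longrightarrow> r \<le> l1_norm (green_op lam x 0)"
      using expands_near_zero[OF lam f_at_0] by blast
    show ?thesis
      by (rule solution_in_annulus[OF lam, of "min r0 R" R 1]) (use r0 R outer in auto)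
  qed
  have a: "\<exists>x. positive_periodic_solution T a g e f lam x"
    if sub: "\<forall>i. ((\<lambda>x. f i x / l1_norm x) \<longlongrightarrow> 0) (filtercomap l1_norm at_top)" and lam: "0 < lam" for lam
  proof -
    obtain R where "0 < R" "\<And>x. x \<in> shell R \<Longrightarrow> l1_norm (green_op lam x 0) \<le> R"
      using contracts_at_infinity_if_sublinear[OF lam] sub by blast
    then show ?thesis using small[OF lam] by blast
  qed
  have b: "\<exists>x y. x \<noteq> y \<and> positive_periodic_solution T a g e f lam x \<and> positive_periodic_solution T a g e f lam y"
    if super: "\<forall>i. filterlim (\<lambda>x. f i x / l1_norm x) at_top (filtercomap l1_norm at_top)"
      and lam: "0 < lam" "lam < lam0" for lam
  proof -
    obtain x \<rho> where x: "\<rho> \<le> 1" "x \<in> shell \<rho>" "l1_norm (green_op lam x 0) = \<rho>"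
      "positive_periodic_solution T a g e f lam (periodic_extension T x)"
      using small[OF lam(1) zero_less_one less_imp_le[OF unit[OF lam]]] by blast
    obtain R0 where R0: "\<And>R y. R0 \<le> R \<Longrightarrow> y \<in> shell R \<Longrightarrow> R \<le> l1_norm (green_op lam y 0)"
      using expands_at_infinity_if_superlinear[OF lam(1)] super by blast
    \<comment> \<open>Expansion (sign \<open>-1\<close>): sizes decrease on the unit shell and increase on a large one.\<close>
    obtain y \<rho>' where y: "1 \<le> \<rho>'" "y \<in> shell \<rho>'" "l1_norm (green_op lam y 0) = \<rho>'"
      "positive_periodic_solution T a g e f lam (periodic_extension T y)"
      by (rule solution_in_annulus[OF lam(1), of 1 "max 1 R0" "-1"])
         (use less_imp_le[OF unit[OF lam]] R0[of "max 1 R0"] in auto)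
    have "\<rho> \<noteq> 1" "\<rho>' \<noteq> 1" using unit[OF lam] x y by fastforce+
    then have "l1_norm (periodic_extension T x 0) \<noteq> l1_norm (periodic_extension T y 0)"
      using x y by (auto simp: periodic_extension_def shell_def)
    then show ?thesis using x y by metis
  qed
  have c: "\<exists>x. positive_periodic_solution T a g e f lam x" if "0 < lam" "lam < lam0" for lam
    using small[OF that(1) zero_less_one less_imp_le[OF unit[OF that]]] by blast
  show ?thesis
    using a b c by (intro conjI impI allI exI[of _ lam0] lam0) blast+
qed

end
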